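(* Let $\Psi$ be a finite Young function, let $(\Omega_0,\mathcal{F}_0,\mathbb{P}_0)$ be an atomless probability space, and let $\mathcal{R}_\rho:\mathcal{M}(H^\Psi)\to\mathbb{R}$ be the risk functional associated with any law-invariant convex risk measure $\rho$ on $H^\Psi=H^\Psi(\Omega_0,\mathcal{F}_0,\mathbb{P}_0)$. Let $A_d:\mathbb{R}^d\to\mathbb{R}$ be a Borel measurable map for which there exist constants $b,c>0$ such that $|A_d(\boldsymbol{x})|\le b+c\sum_{i=1}^d|x_i|$ for all $\boldsymbol{x}=(x_1,\ldots,x_d)\in\mathbb{R}^d$. Fix $\mu_1,\ldots,\mu_d\in\mathcal{M}(H^\Psi)$. Then the restriction of $\mathcal{R}_\rho$ to $M(\mu_1,\dots,\mu_d;A_d)$ is continuous for the relative weak topology. In particular, the sequence of plug-in estimators $(\widehat T_n)$, $\widehat T_n(\boldsymbol{x}):=\mathcal{R}_\rho(\frac1n\sum_{i=1}^n\delta_{x_i})$ for $\boldsymbol{x}=(x_1,x_2,\ldots)\in\mathbb{R}^{\mathbb{N}}$, is robust on $M(\mu_1,\dots,\mu_d;A_d)$.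
   Context: A finite Young function is a continuous nondecreasing convex function $\Psi:\mathbb{R}_+\to\mathbb{R}_+$ with $\Psi(0)=0$ and $\lim_{x\uparrow\infty}\Psi(x)=\infty$. The Orlicz heart on an atomless probability space $(\Omega_0,\mathcal{F}_0,\mathbb{P}_0)$ is $H^\Psi:=\{X\in L^0:\ \mathbb{E}[\Psi(c|X|)]<\infty\text{ for all }c>0\}$, and $\mathcal{M}(H^\Psi)$ is the set of the distributions (Borel probability measures on $\mathbb{R}$) of all random variables from $H^\Psi$. A law-invariant convex risk measure on $H^\Psi$ is a map $\rho:H^\Psi\to\mathbb{R}$ satisfying: $\rho(X)\ge\rho(Y)$ whenever $X\le Y$ $\mathbb{P}_0$-a.s.; $\rho(\lambda X+(1-\lambda)Y)\le\lambda\rho(X)+(1-\lambda)\rho(Y)$ for $\lambda\in[0,1]$; $\rho(X)=\rho(Y)$ whenever $X$ and $Y$ have the same law. The associated risk functional $\mathcal{R}_\rho:\mathcal{M}(H^\Psi)\to\mathbb{R}$ is determined by $\rho(X)=\mathcal{R}_\rho(\mathbb{P}_0\circ X^{-1})$, $X\in H^\Psi$. (The empirical measures $\frac1n\sum_{i=1}^n\delta_{x_i}$ belong to $\mathcal{M}(H^\Psi)$.) $\boldsymbol{\mathcal{M}}(d;\mu_1,\dots,\mu_d)$ is the set of all Borel probability measures on $\mathbb{R}^d$ whose one-dimensional marginal distributions are $\mu_1,\dots,\mu_d$, and $M(\mu_1,\dots,\mu_d;A_d):=\{\boldsymbol{\mu}\circ A_d^{-1}:\boldsymbol{\mu}\in\boldsymbol{\mathcal{M}}(d;\mu_1,\dots,\mu_d)\}$.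 Robustness: for a Borel probability measure $\mu$ on $\mathbb{R}$ let $\mathbb{P}^\mu:=\mu^{\otimes\mathbb{N}}$ on $\mathbb{R}^{\mathbb{N}}$, and let $\pi$ be the Prohorov metric on the Borel probability measures on $\mathbb{R}$. The sequence $(\widehat T_n)$ is robust on a set $M$ of Borel probability measures on $\mathbb{R}$ if for every $\mu\in M$ and $\varepsilon>0$ there is an open neighborhood $U$ of $\mu$ for the relative weak topology on $M$ such that $\pi(\mathbb{P}^\mu\circ\widehat T_n^{-1},\mathbb{P}^\nu\circ\widehat T_n^{-1})\le\varepsilon$ for all $\nu\in U$ and all $n\in\mathbb{N}$. *)

theory Defs
  imports "HOL-Probability.Probability"
begin

section \<open>Orlicz hearts and law-invariant convex risk measures\<close>

text \<open>Functions on the nonnegative half-line are represented by functions \<open>real \<Rightarrow> real\<close>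
  of which only the values on \<open>{0..}\<close> matter.\<close>

definition finite_young_function :: "(real \<Rightarrow> real) \<Rightarrow> bool" where
  "finite_young_function \<Psi> \<longleftrightarrow>
     (\<forall>x\<ge>0. \<Psi> x \<ge> 0) \<and> continuous_on {0..} \<Psi> \<and> mono_on {0..} \<Psi> \<and> convex_on {0..} \<Psi> \<and>
     \<Psi> 0 = 0 \<and> filterlim \<Psi> at_top at_top"

definition atomless_prob_space :: "'a measure \<Rightarrow> bool" where
  "atomless_prob_space P \<longleftrightarrow> prob_space P \<and>
     (\<forall>A\<in>sets P. measure P A > 0 \<longrightarrow>
        (\<exists>B\<in>sets P. B \<subseteq> A \<and> 0 < measure P B \<and> measure P B < measure P A))"

text \<open>Elements of \<open>L\<^sup>0\<close> are represented by measurable functions, not by their almost sure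
  equivalence classes. A law-invariant functional takes the same value on almost surely equal
  representatives, so it is the same thing as a functional on the classes.\<close>

definition orlicz_heart :: "'a measure \<Rightarrow> (real \<Rightarrow> real) \<Rightarrow> ('a \<Rightarrow> real) set" where
  "orlicz_heart P \<Psi> =
     {X \<in> borel_measurable P. \<forall>c>0. (\<integral>\<^sup>+\<omega>. ennreal (\<Psi> (c * \<bar>X \<omega>\<bar>)) \<partial>P) < \<infinity>}"

definition orlicz_heart_laws :: "'a measure \<Rightarrow> (real \<Rightarrow> real) \<Rightarrow> real measure set" where
  "orlicz_heart_laws P \<Psi> = {distr P borel X | X. X \<in> orlicz_heart P \<Psi>}"

text \<open>Monotone (in the decreasing sense), convex and law-invariant; cash additivity is not
  required.\<close>

definition law_invariant_convex_risk_measure ::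
  "'a measure \<Rightarrow> (real \<Rightarrow> real) \<Rightarrow> (('a \<Rightarrow> real) \<Rightarrow> real) \<Rightarrow> bool" where
  "law_invariant_convex_risk_measure P \<Psi> \<rho> \<longleftrightarrow>
     (\<forall>X\<in>orlicz_heart P \<Psi>. \<forall>Y\<in>orlicz_heart P \<Psi>. (AE \<omega> in P. X \<omega> \<le> Y \<omega>) \<longrightarrow> \<rho> X \<ge> \<rho> Y) \<and>
     (\<forall>X\<in>orlicz_heart P \<Psi>. \<forall>Y\<in>orlicz_heart P \<Psi>. \<forall>t\<in>{0..1}.
        \<rho> (\<lambda>\<omega>. t * X \<omega> + (1 - t) * Y \<omega>) \<le> t * \<rho> X + (1 - t) * \<rho> Y) \<and>
     (\<forall>X\<in>orlicz_heart P \<Psi>. \<forall>Y\<in>orlicz_heart P \<Psi>. distr P borel X = distr P borel Y \<longrightarrow> \<rho> X = \<rho> Y)"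

text \<open>This determines \<open>R\<close> on \<open>orlicz_heart_laws P \<Psi>\<close>; values elsewhere are arbitrary.\<close>

definition is_risk_functional ::
  "'a measure \<Rightarrow> (real \<Rightarrow> real) \<Rightarrow> (('a \<Rightarrow> real) \<Rightarrow> real) \<Rightarrow> (real measure \<Rightarrow> real) \<Rightarrow> bool" where
  "is_risk_functional P \<Psi> \<rho> R \<longleftrightarrow> (\<forall>X\<in>orlicz_heart P \<Psi>. \<rho> X = R (distr P borel X))"

section \<open>Aggregation under fixed marginals\<close>

text \<open>\<open>space (prob_algebra borel)\<close> is the set of all Borel probability measures.\<close>

definition frechet_class :: "('d::finite \<Rightarrow> real measure) \<Rightarrow> (real ^ 'd) measure set" where
  "frechet_class \<mu> =
     {m \<in> space (prob_algebra borel). \<forall>i. distr m borel (\<lambda>x. x $ i) = \<mu> i}"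

definition aggregate_laws ::
  "('d::finite \<Rightarrow> real measure) \<Rightarrow> (real ^ 'd \<Rightarrow> real) \<Rightarrow> real measure set" where
  "aggregate_laws \<mu> A = {distr m borel A | m. m \<in> frechet_class \<mu>}"

section \<open>Weak topology, Prohorov metric, robustness\<close>

text \<open>The coarsest topology on the Borel probability measures that makes
  \<open>\<mu> \<mapsto> \<integral>f d\<mu>\<close> continuous for every bounded continuous \<open>f\<close>.\<close>

definition weak_topology :: "'a::topological_space measure topology" where
  "weak_topology = topology_generated_by
     {{\<mu> \<in> space (prob_algebra borel). (\<integral>x. f x \<partial>\<mu>) \<in> V} | (f :: 'a \<Rightarrow> real) V.
        continuous_on UNIV f \<and> bounded (range f) \<and> open V}"

lemma topspace_weak_topology: "topspace weak_topology = space (prob_algebra borel)"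
proof -
  have "space (prob_algebra borel) \<in>
     {{\<mu> \<in> space (prob_algebra borel). (\<integral>x. f x \<partial>\<mu>) \<in> V} | (f :: 'a \<Rightarrow> real) V.
        continuous_on UNIV f \<and> bounded (range f) \<and> open V}"
    by (rule CollectI, rule exI[of _ "\<lambda>_. 0"], rule exI[of _ UNIV]) auto
  then show ?thesis
    unfolding weak_topology_def topology_generated_by_topspace by blast
qed

definition prohorov_dist :: "'a::metric_space measure \<Rightarrow> 'a measure \<Rightarrow> real" where
  "prohorov_dist \<mu> \<nu> = Inf {\<epsilon>. \<epsilon> > 0 \<and> (\<forall>B\<in>sets borel.
     measure \<mu> B \<le> measure \<nu> {x. \<exists>a\<in>B. dist x a < \<epsilon>} + \<epsilon> \<and>
     measure \<nu> B \<le> measure \<mu> {x. \<exists>a\<in>B. dist x a < \<epsilon>} + \<epsilon>)}"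

text \<open>Sequences are indexed from 0, so the sample of size \<open>n\<close> consists of the coordinates
  \<open>0, \<dots>, n - 1\<close>; sample sizes are \<open>n \<ge> 1\<close>. Measurability of the estimators is
  required because \<open>distr\<close> is the image measure only for measurable maps.\<close>

definition robust_on :: "(nat \<Rightarrow> (nat \<Rightarrow> real) \<Rightarrow> real) \<Rightarrow> real measure set \<Rightarrow> bool" where
  "robust_on T M \<longleftrightarrow>
     (\<forall>n\<ge>1. T n \<in> borel_measurable (Pi\<^sub>M UNIV (\<lambda>_. borel))) \<and>
     (\<forall>\<mu>\<in>M. \<forall>\<epsilon>>0. \<exists>U. openin (subtopology weak_topology M) U \<and> \<mu> \<in> U \<and>
        (\<forall>\<nu>\<in>U. \<forall>n\<ge>1. prohorov_dist (distr (Pi\<^sub>M UNIV (\<lambda>_. \<mu>)) borel (T n))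
                               (distr (Pi\<^sub>M UNIV (\<lambda>_. \<nu>)) borel (T n)) \<le> \<epsilon>))"

definition empirical_measure :: "nat \<Rightarrow> (nat \<Rightarrow> real) \<Rightarrow> real measure" where
  "empirical_measure n x = distr (uniform_count_measure {..<n}) borel x"

lemma measure_empirical_measure:
  assumes "n \<ge> 1" "B \<in> sets borel"
  shows "measure (empirical_measure n x) B = (1 / real n) * (\<Sum>i<n. measure (return borel (x i)) B)"
proof -
  have m: "x \<in> uniform_count_measure {..<n} \<rightarrow>\<^sub>M borel"
    by (simp add: measurable_def sets_uniform_count_measure space_uniform_count_measure)
  have "(\<Sum>i<n. measure (return borel (x i)) B) = (\<Sum>i<n. indicator (x -` B) i)"
    using assms by (intro sum.cong) (auto simp: measure_return indicator_def)
  also have "\<dots> = real (card (x -` B \<inter> {..<n}))"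
    by (simp add: indicator_def sum.If_cases Int_commute vimage_def)
  finally show ?thesis
    using assms m unfolding empirical_measure_def
    by (simp add: measure_distr space_uniform_count_measure measure_uniform_count_measure)
qed

end

theory Submission
  imports Defs
begin

text \<open>A finite convex decreasing functional \<open>\<rho>\<close> on the heart is continuous along sequences that
  converge in the heart (extended Namioka-Klee). If laws converge weakly and the integrals of
  \<open>\<Psi> (k \<bar>x\<bar>)\<close> over \<open>{a < \<bar>x\<bar>}\<close> are uniformly small for every \<open>k\<close>, then their Skorohod
  representations on the atomless space converge in the heart, so \<open>R\<close> is continuous along such
  sequences. The laws in \<open>aggregate_laws \<mu> A\<close> have uniformly small tails: if \<open>\<bar>A x\<bar>\<close> is large, it is
  at most a constant multiple of some \<open>\<bar>x $ i\<bar>\<close>, and the marginals are fixed.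

  For robustness, large samples are controlled uniformly over a neighbourhood: Hoeffding's
  inequality brings the empirical measure weakly close to \<open>\<mu>\<close>, and Markov's inequality bounds its
  tails, so the estimator is close to \<open>R \<mu>\<close> under both laws. For each of the finitely many remaining
  sample sizes the estimator is a continuous function of the sample, and independent copies of a
  Skorohod coupling apply.\<close>

section \<open>Atomless probability spaces\<close>

text \<open>Continuity of \<open>R\<close> on \<open>aggregate_laws \<mu> A\<close> alone does not
  give robustness: the estimator evaluates \<open>R\<close> at empirical measures, and these need
  not belong to that set. The criterion \<open>R_near\<close> therefore ranges over all laws of the
  heart. It asks for membership in a weak ball and for finitely many tail bounds, and empirical
  measures satisfy both with high probability, uniformly over a neighbourhood. \<Psi> may violate
  every doubling condition, so integrability of \<Psi>(|x|) says nothing about \<Psi>(2|x|). This is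
  why convergence and tails are demanded at every scale \<open>k\<close>. In return a constant
  factor costs only a change of scale, which absorbs both the growth constant of \<open>A\<close>
  and the factor 2 from differences. The Namioka-Klee argument runs without a norm: differences that
  vanish fast enough have a common majorant \<open>W\<close> in the heart, and one value of \<rho>
  then controls the whole sequence.\<close>

lemma atomless_small_subset:
  assumes P: "atomless_prob_space P" and A: "A \<in> sets P" "measure P A > 0" and e: "e > 0"
  shows "\<exists>B\<in>sets P. B \<subseteq> A \<and> 0 < measure P B \<and> measure P B \<le> e"
proof -
  interpret prob_space P using P by (simp add: atomless_prob_space_def)
  have halve: "\<exists>B\<in>sets P. B \<subseteq> A \<and> 0 < measure P B \<and> measure P B \<le> measure P A / 2 ^ n" for n :: nat
  proof (induction n)
    case 0
    then show ?case using A by auto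
  next
    case (Suc n)
    then obtain B where B: "B \<in> sets P" "B \<subseteq> A" "0 < measure P B" "measure P B \<le> measure P A / 2 ^ n"
      by auto
    obtain C where C: "C \<in> sets P" "C \<subseteq> B" "0 < measure P C" "measure P C < measure P B"
      using P B unfolding atomless_prob_space_def by blast
    have d: "measure P (B - C) = measure P B - measure P C"
      using B C by (intro finite_measure_Diff) auto
    \<comment> \<open>Both \<open>C\<close> and \<open>B - C\<close> have positive measure, and the
      lighter one has at most half the measure of \<open>B\<close>.\<close>
    show ?case
    proof (cases "measure P C \<le> measure P B / 2")
      case True
      have "measure P C \<le> measure P A / 2 ^ Suc n"
        using True B(4) by simp
      then show ?thesis using C B by (intro bexI[of _ C]) auto
    next
      case False
      have "measure P (B - C) \<le> measure P A / 2 ^ Suc n"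
        using False B(4) d by simp
      then show ?thesis using C B d by (intro bexI[of _ "B - C"]) auto
    qed
  qed
  obtain n where n: "(1 / 2) ^ n < e" using real_arch_pow_inv[OF e, of "1/2"] by auto
  obtain B where B: "B \<in> sets P" "B \<subseteq> A" "0 < measure P B" "measure P B \<le> measure P A / 2 ^ n"
    using halve by blast
  have "measure P A / 2 ^ n \<le> (1 / 2) ^ n"
    by (simp add: power_divide divide_right_mono)
  then show ?thesis using B n by (intro bexI[of _ B]) auto
qed

text \<open>Sierpinski's theorem, by greedy exhaustion: each step gains at least half of what can
  still be gained, so an increasing union falling short of \<open>t\<close> would leave room for a further set.\<close>

lemma atomless_subset_of_measure:
  assumes P: "atomless_prob_space P" and A: "A \<in> sets P" and t: "0 \<le> t" "t \<le> measure P A"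
  shows "\<exists>B\<in>sets P. B \<subseteq> A \<and> measure P B = t"
proof -
  interpret prob_space P using P by (simp add: atomless_prob_space_def)
  let ?ok = "\<lambda>B. B \<in> sets P \<and> B \<subseteq> A \<and> measure P B \<le> t"
  let ?fit = "\<lambda>B C. C \<in> sets P \<and> C \<subseteq> A - B \<and> measure P B + measure P C \<le> t"
  have "\<exists>S. \<forall>n. ?ok (S n) \<and> (S n \<subseteq> S (Suc n) \<and>
       (\<forall>C. ?fit (S n) C \<longrightarrow> measure P C \<le> 2 * (measure P (S (Suc n)) - measure P (S n))))"
  proof (rule dependent_nat_choice)
    show "\<exists>B. ?ok B" using t by (intro exI[of _ "{}"]) auto
  next
    fix B :: "'a set" and n :: nat
    assume B: "?ok B"
    define s where "s = (SUP C\<in>{C. ?fit B C}. measure P C)"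
    have bdd: "bdd_above (measure P ` {C. ?fit B C})"
      by (intro bdd_aboveI[of _ 1]) auto
    have ne: "{} \<in> {C. ?fit B C}" using B by auto
    have le_s: "measure P C \<le> s" if "?fit B C" for C
      unfolding s_def using that bdd by (intro cSUP_upper) auto
    show "\<exists>B'. ?ok B' \<and> B \<subseteq> B' \<and>
       (\<forall>C. ?fit B C \<longrightarrow> measure P C \<le> 2 * (measure P B' - measure P B))"
    proof (cases "s \<le> 0")
      case True
      then show ?thesis using B order.trans[OF le_s True] by (intro exI[of _ B]) simp
    next
      case False
      then have "s / 2 < s" by simp
      then obtain C where C: "?fit B C" "s / 2 < measure P C"
        using less_cSUP_iff[OF _ bdd, of "s / 2"] ne unfolding s_def[symmetric] by blast
      have m: "measure P (B \<union> C) = measure P B + measure P C"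
        using B C by (intro finite_measure_Union) auto
      show ?thesis
      proof (intro exI[of _ "B \<union> C"] conjI allI impI)
        fix C' assume "?fit B C'"
        from le_s[OF this] show "measure P C' \<le> 2 * (measure P (B \<union> C) - measure P B)"
          unfolding m using C(2) by simp
      qed (use B C m in auto)
    qed
  qed
  then obtain S where S: "\<And>n. S n \<in> sets P" "\<And>n. S n \<subseteq> A" "\<And>n. measure P (S n) \<le> t"
      "\<And>n. S n \<subseteq> S (Suc n)"
      "\<And>n C. ?fit (S n) C \<Longrightarrow> measure P C \<le> 2 * (measure P (S (Suc n)) - measure P (S n))"
    by metis
  define B where "B = (\<Union>n. S n)"
  have lim: "(\<lambda>n. measure P (S n)) \<longlonglongrightarrow> measure P B"
    unfolding B_def using S(1) incseq_SucI[of S, OF S(4)] by (intro finite_Lim_measure_incseq) auto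
  have Bt: "measure P B \<le> t"
    using lim S(3) by (intro LIMSEQ_le_const2) auto
  have Bs: "B \<in> sets P" "B \<subseteq> A" using S by (auto simp: B_def)
  have "measure P B = t"
  proof (rule ccontr)
    assume "measure P B \<noteq> t"
    then have lt: "measure P B < t" using Bt by simp
    have "measure P (A - B) = measure P A - measure P B"
      using A Bs by (intro finite_measure_Diff) auto
    then have "measure P (A - B) > 0" using lt t by simp
    then obtain C where C: "C \<in> sets P" "C \<subseteq> A - B" "0 < measure P C" "measure P C \<le> t - measure P B"
      using atomless_small_subset[OF P, of "A - B" "t - measure P B"] lt A Bs by auto
    have "?fit (S n) C" for n
    proof -
      have "measure P (S n) \<le> measure P B"
        using S Bs by (intro finite_measure_mono) (auto simp: B_def)
      then show ?thesis using C by (auto simp: B_def)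
    qed
    then have "measure P C \<le> 2 * (measure P (S (Suc n)) - measure P (S n))" for n
      using S(5) by blast
    moreover have "(\<lambda>n. 2 * (measure P (S (Suc n)) - measure P (S n))) \<longlonglongrightarrow> 2 * (measure P B - measure P B)"
      by (intro tendsto_intros lim LIMSEQ_Suc[OF lim])
    ultimately have "measure P C \<le> 2 * (measure P B - measure P B)"
      by (intro LIMSEQ_le_const) auto
    then show False using C by simp
  qed
  then show ?thesis using Bs by auto
qed

lemma atomless_midpoint:
  assumes P: "atomless_prob_space P" and "A \<in> sets P" "B \<in> sets P" "A \<subseteq> B"
  shows "\<exists>C\<in>sets P. A \<subseteq> C \<and> C \<subseteq> B \<and> measure P C = (measure P A + measure P B) / 2"
proof -
  interpret prob_space P using P by (simp add: atomless_prob_space_def)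
  have d: "measure P (B - A) = measure P B - measure P A"
    using assms by (intro finite_measure_Diff) auto
  have "measure P A \<le> measure P B" using assms by (intro finite_measure_mono) auto
  then obtain C where C: "C \<in> sets P" "C \<subseteq> B - A" "measure P C = (measure P B - measure P A) / 2"
    using atomless_subset_of_measure[OF P, of "B - A" "(measure P B - measure P A) / 2"] assms d by auto
  have "measure P (A \<union> C) = measure P A + measure P C"
    using assms C by (intro finite_measure_Union) auto
  then show ?thesis using C assms by (intro bexI[of _ "A \<union> C"]) (auto simp: field_simps)
qed

section \<open>A uniform random variable on an atomless space\<close>

lemma atomless_dyadic_chain:
  assumes P: "atomless_prob_space P"
  obtains D :: "nat \<Rightarrow> nat \<Rightarrow> 'a set"
  where "\<And>n k. D n k \<in> sets P" and "\<And>n k. D n k \<subseteq> D n (Suc k)"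
    and "\<And>n k. D (Suc n) (2 * k) = D n k" and "\<And>n k. k \<le> 2 ^ n \<Longrightarrow> measure P (D n k) = k / 2 ^ n"
    and "\<And>n. D n (2 ^ n) = space P"
proof -
  interpret prob_space P using P by (simp add: atomless_prob_space_def)
  define mid where "mid A B = (SOME C. C \<in> sets P \<and> A \<subseteq> C \<and> C \<subseteq> B \<and>
      measure P C = (measure P A + measure P B) / 2)" for A B
  have mid: "mid A B \<in> sets P \<and> A \<subseteq> mid A B \<and> mid A B \<subseteq> B \<and>
      measure P (mid A B) = (measure P A + measure P B) / 2"
    if "A \<in> sets P" "B \<in> sets P" "A \<subseteq> B" for A B
    unfolding mid_def by (rule someI_ex) (use atomless_midpoint[OF P that] in blast)
  \<comment> \<open>\<open>D n k\<close> plays the role of the event that a uniform variable is at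
    most \<open>k / 2 ^ n\<close>: even indices repeat the previous level, odd ones insert
    midpoints. Starting with \<open>space P\<close> at every positive index makes the inclusions
    hold for all \<open>k\<close>, also beyond \<open>2 ^ n\<close>.\<close>
  define D where "D = rec_nat (\<lambda>k::nat. if k = 0 then {} else space P)
     (\<lambda>n E k. if even k then E (k div 2) else mid (E (k div 2)) (E (Suc (k div 2))))"
  have D0: "D 0 k = (if k = 0 then {} else space P)" for k by (simp add: D_def)
  have DS: "D (Suc n) k = (if even k then D n (k div 2) else mid (D n (k div 2)) (D n (Suc (k div 2))))"
    for n k by (simp add: D_def)
  have inv: "\<forall>k. D n k \<in> sets P \<and> D n k \<subseteq> D n (Suc k)" for n
  proof (induction n)
    case 0
    then show ?case by (auto simp: D0)
  next
    case (Suc n)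
    show ?case
    proof
      fix k
      show "D (Suc n) k \<in> sets P \<and> D (Suc n) k \<subseteq> D (Suc n) (Suc k)"
        using Suc mid[of "D n (k div 2)" "D n (Suc (k div 2))"]
        by (cases "even k") (auto simp: DS)
    qed
  qed
  have meas: "\<forall>k\<le>2 ^ n. measure P (D n k) = k / 2 ^ n" for n
  proof (induction n)
    case 0
    then show ?case by (auto simp: D0 prob_space le_Suc_eq)
  next
    case (Suc n)
    show ?case
    proof (intro allI impI)
      fix k :: nat assume k: "k \<le> 2 ^ Suc n"
      show "measure P (D (Suc n) k) = k / 2 ^ Suc n"
      proof (cases "even k")
        case True
        then obtain j where "k = 2 * j" by blast
        then show ?thesis using Suc k by (auto simp: DS)
      next
        case False
        then obtain j where j: "k = 2 * j + 1" by (auto elim: oddE)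
        then have "Suc j \<le> 2 ^ n" using k by simp
        then have "measure P (D n j) = j / 2 ^ n" "measure P (D n (Suc j)) = Suc j / 2 ^ n"
          using Suc by auto
        then show ?thesis
          using mid[of "D n j" "D n (Suc j)"] inv j by (simp add: DS add_divide_distrib[symmetric] ac_simps)
      qed
    qed
  qed
  have full: "D n (2 ^ n) = space P" for n by (induction n) (simp_all add: D0 DS)
  show ?thesis
    by (rule that[of D]) (use inv meas full in \<open>auto simp: DS\<close>)
qed

text \<open>An infimum lies below \<open>t\<close> exactly if some element does, so
  \<open>U \<omega> < t\<close> defines a countable union of chain sets. This gives measurability
  and explains the strict inequality; the measure is then squeezed between dyadic approximations of
  \<open>t\<close>.\<close>

lemma atomless_uniform_less:
  fixes P :: "'a measure"
  assumes P: "atomless_prob_space P"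
  obtains U :: "'a \<Rightarrow> real"
  where "U \<in> borel_measurable P" and "\<And>t. 0 \<le> t \<Longrightarrow> t \<le> 1 \<Longrightarrow> measure P {\<omega>\<in>space P. U \<omega> < t} = t"
proof -
  interpret prob_space P using P by (simp add: atomless_prob_space_def)
  obtain D :: "nat \<Rightarrow> nat \<Rightarrow> 'a set" where D: "\<And>n k. D n k \<in> sets P" "\<And>n k. D n k \<subseteq> D n (Suc k)"
    "\<And>n k. D (Suc n) (2 * k) = D n k" "\<And>n k. k \<le> 2 ^ n \<Longrightarrow> measure P (D n k) = k / 2 ^ n"
    "\<And>n. D n (2 ^ n) = space P"
    using atomless_dyadic_chain[OF P] by blast
  have refine: "D (n + j) (2 ^ j * k) = D n k" for n j k
    by (induction j) (simp_all add: D(3) mult.assoc)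
  have mono: "D n k \<subseteq> D n' k'" if "real k / 2 ^ n \<le> real k' / 2 ^ n'" for n k n' k'
  proof -
    \<comment> \<open>Both sets are moved to the common level \<open>n + n'\<close>, where inclusion
      is monotonicity in the index.\<close>
    have "real (2 ^ n' * k) \<le> real (2 ^ n * k')" using that by (simp add: field_simps)
    then have "2 ^ n' * k \<le> 2 ^ n * k'" unfolding of_nat_le_iff .
    then have "D (n + n') (2 ^ n' * k) \<subseteq> D (n + n') (2 ^ n * k')"
      by (rule lift_Suc_mono_le[of "D (n + n')", OF D(2)])
    then show ?thesis using refine[of n n' k] refine[of n' n k'] by (simp add: add.commute)
  qed
  define G where "G \<omega> = {real k / 2 ^ n | n k. k \<le> 2 ^ n \<and> \<omega> \<in> D n k}" for \<omega>
  define U where "U \<omega> = Inf (G \<omega>)" for \<omega>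
  have ne: "1 \<in> G \<omega>" if "\<omega> \<in> space P" for \<omega>
    using that D(5)[of 0] unfolding G_def by (intro CollectI exI[of _ 0] exI[of _ 1]) auto
  have bdd: "bdd_below (G \<omega>)" for \<omega> unfolding G_def by (intro bdd_belowI[of _ 0]) auto
  have less: "{\<omega>\<in>space P. U \<omega> < t} = (\<Union>n. \<Union>k\<in>{k. k \<le> 2 ^ n \<and> real k / 2 ^ n < t}. D n k)" for t
  proof -
    have "U \<omega> < t \<longleftrightarrow> (\<exists>n k. k \<le> 2 ^ n \<and> real k / 2 ^ n < t \<and> \<omega> \<in> D n k)" if "\<omega> \<in> space P" for \<omega>
      unfolding U_def using cInf_less_iff[OF _ bdd, of \<omega> t] ne[OF that] by (auto simp: G_def)
    moreover have "D n k \<subseteq> space P" for n k by (rule sets.sets_into_space[OF D(1)])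
    ultimately show ?thesis by auto
  qed
  have sets_less: "{\<omega>\<in>space P. U \<omega> < t} \<in> sets P" for t
    unfolding less by (rule sets.countable_UN''[OF countableI_type], rule sets.countable_UN''[OF countableI_type D(1)])
  have meas: "U \<in> borel_measurable P"
    by (rule borel_measurableI_less) (rule sets_less)
  have "measure P {\<omega>\<in>space P. U \<omega> < t} = t" if t: "0 \<le> t" "t \<le> 1" for t
  proof (rule antisym)
    have low: "t - (1/2) ^ n \<le> measure P {\<omega>\<in>space P. U \<omega> < t}" for n
    proof (cases "t = 0")
      case False
      \<comment> \<open>The largest integer with \<open>k / 2 ^ n < t\<close>: the ceiling minus
        one, not the floor, because the inequality must be strict.\<close>
      define k where "k = nat (\<lceil>t * 2 ^ n\<rceil> - 1)"
      have pos: "t * 2 ^ n > 0" using t False by simp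
      have k: "real k < t * 2 ^ n" "t * 2 ^ n \<le> real k + 1"
        using pos unfolding k_def by linarith+
      have "t * 2 ^ n \<le> 2 ^ n" using t by simp
      then have "real k \<le> 2 ^ n" using k by linarith
      then have k2: "k \<le> 2 ^ n" by (metis of_nat_le_iff of_nat_numeral of_nat_power)
      have "D n k \<subseteq> {\<omega>\<in>space P. U \<omega> < t}"
        unfolding less using k2 k by (auto simp: field_simps)
      then have "measure P (D n k) \<le> measure P {\<omega>\<in>space P. U \<omega> < t}"
        by (intro finite_measure_mono sets_less)
      moreover have "t - (1/2) ^ n \<le> k / 2 ^ n"
        using divide_right_mono[of "t * 2 ^ n" "real k + 1" "2 ^ n"] k
        by (simp add: add_divide_distrib power_divide)
      ultimately show ?thesis using D(4)[OF k2] by simp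
    qed (simp add: order.trans[OF _ measure_nonneg])
    have lim: "(\<lambda>n. t - (1/2) ^ n) \<longlonglongrightarrow> t - 0" "(\<lambda>n. t + (1/2) ^ n) \<longlonglongrightarrow> t + 0"
      by (intro tendsto_intros LIMSEQ_realpow_zero; simp)+
    show "t \<le> measure P {\<omega>\<in>space P. U \<omega> < t}"
      using LIMSEQ_le_const2[OF lim(1)] low by auto
    have up: "measure P {\<omega>\<in>space P. U \<omega> < t} \<le> t + (1/2) ^ n" for n
    proof -
      \<comment> \<open>The smallest integer with \<open>t \<le> k / 2 ^ n\<close>, so that
        \<open>D n k\<close> contains every set of the union.\<close>
      define k where "k = nat \<lceil>t * 2 ^ n\<rceil>"
      have k: "t * 2 ^ n \<le> real k" "real k < t * 2 ^ n + 1"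
      proof -
        have "0 \<le> \<lceil>t * 2 ^ n\<rceil>" using t by (simp add: less_le_trans[of "-1" 0])
        then have "real k = of_int \<lceil>t * 2 ^ n\<rceil>" by (simp add: k_def)
        then show "t * 2 ^ n \<le> real k" "real k < t * 2 ^ n + 1"
          using ceiling_correct[of "t * 2 ^ n"] by linarith+
      qed
      have "t * 2 ^ n \<le> real_of_int (2 ^ n)" using t by simp
      then have "\<lceil>t * 2 ^ n\<rceil> \<le> 2 ^ n" by (rule ceiling_le)
      then have k2: "k \<le> 2 ^ n" unfolding k_def by (simp add: nat_le_iff)
      have "{\<omega>\<in>space P. U \<omega> < t} \<subseteq> D n k"
      proof -
        have "D n' k' \<subseteq> D n k" if "real k' / 2 ^ n' < t" for n' k'
        proof (rule mono)
          have "t \<le> real k / 2 ^ n" using k by (simp add: field_simps)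
          then show "real k' / 2 ^ n' \<le> real k / 2 ^ n" using that by linarith
        qed
        then show ?thesis unfolding less by blast
      qed
      then have "measure P {\<omega>\<in>space P. U \<omega> < t} \<le> k / 2 ^ n"
        using finite_measure_mono[OF _ D(1)] D(4)[OF k2] by metis
      also have "\<dots> \<le> t + (1/2) ^ n"
        using divide_right_mono[of "real k" "t * 2 ^ n + 1" "2 ^ n"] k
        by (simp add: add_divide_distrib power_divide)
      finally show ?thesis .
    qed
    show "measure P {\<omega>\<in>space P. U \<omega> < t} \<le> t"
      using LIMSEQ_le_const[OF lim(2)] up by auto
  qed
  then show ?thesis using that meas by blast
qed

abbreviation unit_uniform :: "real measure" where
  "unit_uniform \<equiv> restrict_space lborel {0<..<1}"

text \<open>The law is expressed through the identity on the open unit interval, because that is the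
  space on which the inverse of a distribution function is known to have the prescribed law.\<close>

lemma atomless_uniform:
  fixes P :: "'a measure"
  assumes P: "atomless_prob_space P"
  obtains U :: "'a \<Rightarrow> real"
  where "U \<in> borel_measurable P" and "distr P borel U = distr unit_uniform borel (\<lambda>x. x)"
proof -
  interpret prob_space P using P by (simp add: atomless_prob_space_def)
  obtain U :: "'a \<Rightarrow> real" where U[measurable]: "U \<in> borel_measurable P"
    and less: "\<And>t. 0 \<le> t \<Longrightarrow> t \<le> 1 \<Longrightarrow> measure P {\<omega>\<in>space P. U \<omega> < t} = t"
    using atomless_uniform_less[OF P] by blast
  interpret \<Omega>: prob_space unit_uniform
    by (auto simp add: emeasure_restrict_space space_restrict_space intro!: prob_spaceI)
  have id[measurable]: "(\<lambda>x. x) \<in> borel_measurable unit_uniform"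
    by (intro measurable_restrict_space1) auto
  have "distr P borel U = distr unit_uniform borel (\<lambda>x. x)"
  proof (rule cdf_unique)
    show "real_distribution (distr P borel U)" "real_distribution (distr unit_uniform borel (\<lambda>x. x))"
      by simp_all
    show "cdf (distr P borel U) = cdf (distr unit_uniform borel (\<lambda>x. x))"
    proof
      fix x :: real
      have l: "cdf (distr P borel U) x = measure P {\<omega>\<in>space P. U \<omega> \<le> x}"
        by (auto simp: cdf_def measure_distr intro!: arg_cong[where f="measure P"])
      have r: "cdf (distr unit_uniform borel (\<lambda>x. x)) x = measure lborel ({0<..<1} \<inter> {..x})"
        by (auto simp: cdf_def measure_distr space_restrict_space measure_restrict_space
             intro!: arg_cong[where f="measure lborel"])
      consider "x < 0" | "0 \<le> x" "x < 1" | "1 \<le> x" by linarith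
      then show "cdf (distr P borel U) x = cdf (distr unit_uniform borel (\<lambda>x. x)) x"
      proof cases
        case 1
        have "measure P {\<omega>\<in>space P. U \<omega> \<le> x} \<le> measure P {\<omega>\<in>space P. U \<omega> < 0}"
          using 1 by (intro finite_measure_mono) auto
        then have "measure P {\<omega>\<in>space P. U \<omega> \<le> x} = 0"
          using less[of 0] measure_nonneg[of P "{\<omega>\<in>space P. U \<omega> \<le> x}"] by simp
        moreover have "{0<..<1} \<inter> {..x} = {}" using 1 by auto
        ultimately show ?thesis unfolding l r by simp
      next
        case 2
        have "x \<le> measure P {\<omega>\<in>space P. U \<omega> \<le> x}"
          using 2 less[of x] finite_measure_mono[of "{\<omega>\<in>space P. U \<omega> < x}" "{\<omega>\<in>space P. U \<omega> \<le> x}"]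
          by fastforce
        \<comment> \<open>Only strict sublevel sets have known measure, so
          \<open>{U \<le> x}\<close> is approached by \<open>{U < y}\<close> with \<open>y\<close>
          above \<open>x\<close>.\<close>
        moreover have "measure P {\<omega>\<in>space P. U \<omega> \<le> x} \<le> x"
        proof (rule dense_ge_bounded[of x 1])
          show "x < 1" by fact
          fix y assume y: "x < y" "y < 1"
          have "measure P {\<omega>\<in>space P. U \<omega> \<le> x} \<le> measure P {\<omega>\<in>space P. U \<omega> < y}"
            using y by (intro finite_measure_mono) auto
          then show "measure P {\<omega>\<in>space P. U \<omega> \<le> x} \<le> y" using less[of y] y 2 by simp
        qed
        moreover have "{0<..<1} \<inter> {..x} = {0<..x}" using 2 by auto
        ultimately show ?thesis unfolding l r using 2 by simp
      next
        case 3
        have "measure P {\<omega>\<in>space P. U \<omega> < 1} \<le> measure P {\<omega>\<in>space P. U \<omega> \<le> x}"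
          using 3 by (intro finite_measure_mono) auto
        then have "measure P {\<omega>\<in>space P. U \<omega> \<le> x} = 1"
          using less[of 1] prob_le_1[of "{\<omega>\<in>space P. U \<omega> \<le> x}"] by simp
        moreover have "{0<..<1} \<inter> {..x} = {0<..<1}" using 3 by auto
        ultimately show ?thesis unfolding l r by simp
      qed
    qed
  qed
  then show ?thesis using that U by blast
qed

section \<open>Quantile functions and Skorohod representation\<close>

definition quantile :: "real measure \<Rightarrow> real \<Rightarrow> real" where
  "quantile \<mu> u = (if u \<in> {0<..<1} then Inf {x. u \<le> cdf \<mu> x} else 0)"

lemma quantile_measurable [measurable]:
  assumes "real_distribution \<mu>"
  shows "quantile \<mu> \<in> borel_measurable borel"
proof -
  interpret cdf_distribution \<mu> using assms by (simp add: cdf_distribution_def)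
  show ?thesis
    unfolding quantile_def[abs_def] using measurable_CI
    by (subst measurable_If_restrict_space_iff) (simp, unfold Collect_mem_eq, simp)
qed

text \<open>On the open unit interval \<open>quantile \<mu>\<close> is the pseudoinverse
  \<open>I\<close>, whose law is \<open>\<mu>\<close>. The default 0 elsewhere makes it a measurable
  function on the whole line, so it can be composed with \<open>U\<close>; it is met only on a null
  set.\<close>

lemma distr_quantile:
  assumes "real_distribution \<mu>" and [measurable]: "U \<in> borel_measurable P"
    and U: "distr P borel U = distr unit_uniform borel (\<lambda>x. x)"
  shows "distr P borel (\<lambda>\<omega>. quantile \<mu> (U \<omega>)) = \<mu>"
proof -
  interpret cdf_distribution \<mu> using assms by (simp add: cdf_distribution_def)
  note [measurable] = quantile_measurable[OF assms(1)]
  have id[measurable]: "(\<lambda>x. x) \<in> borel_measurable unit_uniform"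
    by (intro measurable_restrict_space1) auto
  have "distr P borel (\<lambda>\<omega>. quantile \<mu> (U \<omega>)) = distr (distr P borel U) borel (quantile \<mu>)"
    by (simp add: distr_distr comp_def)
  also have "\<dots> = distr unit_uniform borel (quantile \<mu>)"
    unfolding U by (simp add: distr_distr comp_def)
  also have "\<dots> = distr unit_uniform borel I"
    by (rule distr_cong) (auto simp: quantile_def space_restrict_space)
  finally show ?thesis using distr_I_eq_M by simp
qed

text \<open>The equivalence of \<open>v \<le> cdf \<mu> x\<close> and
  \<open>quantile \<mu> v \<le> x\<close> translates convergence of distribution functions into
  convergence of quantiles. Test points \<open>x\<close> must not be atoms; atoms are countable, so
  such points are dense.\<close>

lemma quantile_converges:
  assumes \<nu>: "\<And>n. real_distribution (\<nu> n)" and \<mu>: "real_distribution \<mu>" and conv: "weak_conv_m \<nu> \<mu>"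
    and u: "u \<in> {0<..<1}" and cts: "isCont (quantile \<mu>) u"
  shows "(\<lambda>n. quantile (\<nu> n) u) \<longlonglongrightarrow> quantile \<mu> u"
proof -
  interpret \<nu>: cdf_distribution "\<nu> n" for n using \<nu> by (simp add: cdf_distribution_def)
  interpret \<mu>: cdf_distribution \<mu> using \<mu> by (simp add: cdf_distribution_def)
  have ps: "v \<le> cdf \<mu> x \<longleftrightarrow> quantile \<mu> v \<le> x" if "v \<in> {0<..<1}" for v x
    using \<mu>.pseudoinverse[of v x] that by (simp add: quantile_def)
  have psn: "v \<le> cdf (\<nu> n) x \<longleftrightarrow> quantile (\<nu> n) v \<le> x" if "v \<in> {0<..<1}" for v x n
    using \<nu>.pseudoinverse[of v n x] that by (simp add: quantile_def)
  have lim: "(\<lambda>n. cdf (\<nu> n) x) \<longlonglongrightarrow> cdf \<mu> x" if "measure \<mu> {x} = 0" for x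
    using conv \<mu>.isCont_cdf that by (auto simp: weak_conv_m_def weak_conv_def)
  have cont_point: "\<exists>x. a < x \<and> x < b \<and> measure \<mu> {x} = 0" if "a < b" for a b
    using open_minus_countable[OF \<mu>.countable_support, of "{a<..<b}"] that by auto
  show ?thesis
  proof (rule order_tendstoI)
    fix a assume "a < quantile \<mu> u"
    then obtain x where x: "a < x" "x < quantile \<mu> u" "measure \<mu> {x} = 0" using cont_point by blast
    then have "cdf \<mu> x < u" using ps[OF u, of x] by linarith
    then have "\<forall>\<^sub>F n in sequentially. cdf (\<nu> n) x < u" using order_tendstoD(2)[OF lim[OF x(3)]] by blast
    then show "\<forall>\<^sub>F n in sequentially. a < quantile (\<nu> n) u"
      by eventually_elim (metis psn[OF u] x(1) not_le less_trans)
  next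
    fix a assume a: "quantile \<mu> u < a"
    \<comment> \<open>The bound \<open>u < cdf \<mu> x\<close> must be strict to carry over to
      \<open>\<nu> n\<close>, hence a point \<open>v\<close> to the right of \<open>u\<close>.
      Continuity at \<open>u\<close> keeps \<open>quantile \<mu> v\<close> below
      \<open>a\<close>.\<close>
    have "\<forall>\<^sub>F v in at_right u. quantile \<mu> v < a \<and> v < 1"
    proof (intro eventually_conj)
      show "\<forall>\<^sub>F v in at_right u. quantile \<mu> v < a"
        using order_tendstoD(2)[OF _ a] cts by (auto simp: isCont_def filterlim_at_split)
      show "\<forall>\<^sub>F v in at_right u. v < 1" using u eventually_at_right[of u 1] by auto
    qed
    then have "\<forall>\<^sub>F v in at_right u. (quantile \<mu> v < a \<and> v < 1) \<and> u < v"
      by (rule eventually_conj) (simp add: eventually_at_right_less)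
    then obtain v where v: "quantile \<mu> v < a" "v < 1" "u < v"
      using eventually_happens'[OF trivial_limit_at_right_real] by blast
    obtain x where x: "quantile \<mu> v < x" "x < a" "measure \<mu> {x} = 0" using cont_point[OF v(1)] by blast
    have "v \<le> cdf \<mu> x" using ps[of v x] v x u by auto
    then have "u < cdf \<mu> x" using v by linarith
    then have "\<forall>\<^sub>F n in sequentially. u < cdf (\<nu> n) x" using order_tendstoD(1)[OF lim[OF x(3)]] by blast
    then show "\<forall>\<^sub>F n in sequentially. quantile (\<nu> n) u < a"
      by eventually_elim (metis psn[OF u] x(2) less_imp_le le_less_trans)
  qed
qed

lemma AE_isCont_quantile:
  assumes "real_distribution \<mu>"
  shows "AE u in distr unit_uniform borel (\<lambda>x. x). u \<in> {0<..<1} \<and> isCont (quantile \<mu>) u"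
proof -
  interpret cdf_distribution \<mu> using assms by (simp add: cdf_distribution_def)
  let ?D = "{u\<in>{0<..<1}. \<not> isCont I u}"
  have "countable ?D"
    using mono_on_ctble_discont[OF mono_I] by (simp add: at_within_open[of _ "{0 <..< 1}"] cong: conj_cong)
  then have null: "?D \<in> null_sets lborel" by (rule countable_imp_null_set_lborel)
  then have D: "AE u in lborel. u \<notin> ?D" by (rule AE_not_in)
  have [measurable]: "?D \<in> sets borel" using null by auto
  have *: "isCont (quantile \<mu>) u" if "u \<in> {0<..<1}" "isCont I u" for u
  proof -
    have "\<forall>\<^sub>F v in nhds u. v \<in> {0<..<1}" using that by (intro eventually_nhds_in_open) auto
    then have "\<forall>\<^sub>F v in nhds u. I v = quantile \<mu> v"
      by eventually_elim (simp add: quantile_def)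
    from isCont_cong[OF this] that(2) show ?thesis by simp
  qed
  have "(\<lambda>x. x) \<in> borel_measurable unit_uniform"
    by (intro measurable_restrict_space1) auto
  then have "AE u in distr unit_uniform borel (\<lambda>x. x). u \<in> {0<..<1} - ?D"
    using D by (subst AE_distr_iff) (auto simp: AE_restrict_space_iff elim: eventually_mono)
  then show ?thesis by eventually_elim (use * in auto)
qed

text \<open>A representation on some auxiliary space would not do: \<rho> accepts only variables on
  \<open>P\<close>. One uniform variable of \<open>P\<close> is fed into all quantile
  functions.\<close>

lemma skorohod_on_atomless:
  fixes P :: "'a measure"
  assumes P: "atomless_prob_space P" and \<nu>: "\<And>n. real_distribution (\<nu> n)"
    and \<mu>: "real_distribution \<mu>" and conv: "weak_conv_m \<nu> \<mu>"
  obtains Y :: "nat \<Rightarrow> 'a \<Rightarrow> real" and Z :: "'a \<Rightarrow> real"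
  where "\<And>n. Y n \<in> borel_measurable P" and "\<And>n. distr P borel (Y n) = \<nu> n"
    and "Z \<in> borel_measurable P" and "distr P borel Z = \<mu>"
    and "AE \<omega> in P. (\<lambda>n. Y n \<omega>) \<longlonglongrightarrow> Z \<omega>"
proof -
  obtain U where U[measurable]: "U \<in> borel_measurable P"
    and dU: "distr P borel U = distr unit_uniform borel (\<lambda>x. x)"
    using atomless_uniform[OF P] by blast
  note [measurable] = quantile_measurable[OF \<mu>] quantile_measurable[OF \<nu>]
  have "AE \<omega> in P. U \<omega> \<in> {0<..<1} \<and> isCont (quantile \<mu>) (U \<omega>)"
    using AE_isCont_quantile[OF \<mu>] unfolding dU[symmetric] by (rule AE_distrD[OF U])
  then have "AE \<omega> in P. (\<lambda>n. quantile (\<nu> n) (U \<omega>)) \<longlonglongrightarrow> quantile \<mu> (U \<omega>)"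
    by eventually_elim (use quantile_converges[OF \<nu> \<mu> conv] in blast)
  then show ?thesis
    using that[of "\<lambda>n \<omega>. quantile (\<nu> n) (U \<omega>)" "\<lambda>\<omega>. quantile \<mu> (U \<omega>)"]
      distr_quantile[OF \<nu> U dU] distr_quantile[OF \<mu> U dU] by simp
qed

section \<open>Continuity of risk measures on the Orlicz heart\<close>

lemma ennreal_tendsto_0I:
  fixes f :: "'a \<Rightarrow> ennreal"
  assumes "\<And>e::real. e > 0 \<Longrightarrow> \<forall>\<^sub>F x in F. f x \<le> ennreal e"
  shows "(f \<longlongrightarrow> 0) F"
proof (rule order_tendstoI)
  fix a :: ennreal assume "0 < a"
  then obtain b where b: "0 < b" "b < a" using dense by blast
  obtain e where e: "b = ennreal e" "e > 0"
    using b by (cases b) auto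
  show "\<forall>\<^sub>F x in F. f x < a"
    using assms[OF e(2)] by eventually_elim (use b e in auto)
qed simp

section \<open>Finite Young functions and the Orlicz heart\<close>

locale young_function =
  fixes \<Psi> :: "real \<Rightarrow> real"
  assumes young: "finite_young_function \<Psi>"
begin

lemma nonneg: "0 \<le> x \<Longrightarrow> 0 \<le> \<Psi> x"
  using young by (simp add: finite_young_function_def)

lemma mono: "0 \<le> x \<Longrightarrow> x \<le> y \<Longrightarrow> \<Psi> x \<le> \<Psi> y"
  using young[unfolded finite_young_function_def] monotone_onD[of "{0..}" "(\<le>)" "(\<le>)" \<Psi> x y] by simp

lemma mono_abs: "\<bar>x\<bar> \<le> \<bar>y\<bar> \<Longrightarrow> \<Psi> \<bar>x\<bar> \<le> \<Psi> \<bar>y\<bar>"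
  by (rule mono) auto

lemma zero [simp]: "\<Psi> 0 = 0"
  using young by (simp add: finite_young_function_def)

lemma continuous_abs: "continuous_on UNIV (\<lambda>x. \<Psi> \<bar>x\<bar>)"
proof (rule continuous_on_compose2[of "{0..}" \<Psi> UNIV abs])
  show "continuous_on {0..} \<Psi>" using young by (simp add: finite_young_function_def)
  show "continuous_on UNIV (abs :: real \<Rightarrow> real)" by (rule continuous_on_rabs[OF continuous_on_id])
qed auto

lemma measurable_abs [measurable]:
  assumes "f \<in> borel_measurable M"
  shows "(\<lambda>x. \<Psi> \<bar>f x\<bar>) \<in> borel_measurable M"
  using measurable_compose[OF assms borel_measurable_continuous_onI[OF continuous_abs]] .

lemma exceeds: "\<exists>B\<ge>0. \<forall>x\<ge>0. \<Psi> x \<le> y \<longrightarrow> x \<le> B"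
proof -
  have "filterlim \<Psi> at_top at_top" using young by (simp add: finite_young_function_def)
  then have "\<forall>\<^sub>F x in at_top. y < \<Psi> x" by (simp add: filterlim_at_top_dense)
  then obtain B where B: "\<And>x. x \<ge> B \<Longrightarrow> y < \<Psi> x" by (auto simp: eventually_at_top_linorder)
  show ?thesis
    using B by (intro exI[of _ "max 0 B"]) (meson linorder_not_le max.cobounded1 max.coboundedI2 less_imp_le order.refl)
qed

text \<open>The larger of \<open>\<bar>2 * u\<bar>\<close> and \<open>\<bar>2 * v\<bar>\<close>
  already dominates. The factor 2 is harmless in the heart, where every scale is integrable.\<close>

lemma le_sum_of_twice: "\<bar>x\<bar> \<le> \<bar>u\<bar> + \<bar>v\<bar> \<Longrightarrow> \<Psi> \<bar>x\<bar> \<le> \<Psi> \<bar>2 * u\<bar> + \<Psi> \<bar>2 * v\<bar>"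
proof -
  assume x: "\<bar>x\<bar> \<le> \<bar>u\<bar> + \<bar>v\<bar>"
  have "0 \<le> \<Psi> \<bar>2 * u\<bar>" "0 \<le> \<Psi> \<bar>2 * v\<bar>" by (simp_all only: nonneg abs_ge_zero)
  moreover have "\<bar>x\<bar> \<le> \<bar>2 * u\<bar> \<or> \<bar>x\<bar> \<le> \<bar>2 * v\<bar>" using x by linarith
  ultimately show ?thesis using mono_abs[of x "2 * u"] mono_abs[of x "2 * v"] by linarith
qed

lemma orlicz_heart_iff:
  "X \<in> orlicz_heart P \<Psi> \<longleftrightarrow>
     X \<in> borel_measurable P \<and> (\<forall>c::real. (\<integral>\<^sup>+\<omega>. ennreal (\<Psi> \<bar>c * X \<omega>\<bar>) \<partial>P) < \<infinity>)"
proof -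
  have "(\<forall>c>0. (\<integral>\<^sup>+\<omega>. ennreal (\<Psi> (c * \<bar>X \<omega>\<bar>)) \<partial>P) < \<infinity>) \<longleftrightarrow>
        (\<forall>c::real. (\<integral>\<^sup>+\<omega>. ennreal (\<Psi> \<bar>c * X \<omega>\<bar>) \<partial>P) < \<infinity>)" (is "?l \<longleftrightarrow> ?r")
  proof
    assume l: ?l
    show ?r
    proof
      fix c :: real
      show "(\<integral>\<^sup>+\<omega>. ennreal (\<Psi> \<bar>c * X \<omega>\<bar>) \<partial>P) < \<infinity>"
        using l[rule_format, of "\<bar>c\<bar>"] by (cases "c = 0") (simp_all add: abs_mult)
    qed
  next
    assume r: ?r
    show ?l
    proof (intro allI impI)
      fix c :: real assume "c > 0"
      then show "(\<integral>\<^sup>+\<omega>. ennreal (\<Psi> (c * \<bar>X \<omega>\<bar>)) \<partial>P) < \<infinity>"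
        using r[rule_format, of c] by (simp add: abs_mult)
    qed
  qed
  then show ?thesis by (simp add: orlicz_heart_def)
qed

lemma orlicz_heart_of_nat:
  assumes "X \<in> borel_measurable P" "\<And>k::nat. (\<integral>\<^sup>+\<omega>. ennreal (\<Psi> \<bar>real k * X \<omega>\<bar>) \<partial>P) < \<infinity>"
  shows "X \<in> orlicz_heart P \<Psi>"
  unfolding orlicz_heart_iff
proof (intro conjI allI)
  fix c :: real
  obtain k :: nat where k: "\<bar>c\<bar> \<le> real k" using real_arch_simple by blast
  have "(\<integral>\<^sup>+\<omega>. ennreal (\<Psi> \<bar>c * X \<omega>\<bar>) \<partial>P) \<le> (\<integral>\<^sup>+\<omega>. ennreal (\<Psi> \<bar>real k * X \<omega>\<bar>) \<partial>P)"
    using k by (intro nn_integral_mono ennreal_leI mono_abs) (simp add: abs_mult mult_right_mono)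
  then show "(\<integral>\<^sup>+\<omega>. ennreal (\<Psi> \<bar>c * X \<omega>\<bar>) \<partial>P) < \<infinity>"
    using assms(2)[of k] by (rule le_less_trans)
qed (rule assms(1))

lemma orlicz_heart_scale:
  assumes "X \<in> orlicz_heart P \<Psi>"
  shows "(\<lambda>\<omega>. a * X \<omega>) \<in> orlicz_heart P \<Psi>"
  using assms unfolding orlicz_heart_iff by (auto simp flip: mult.assoc)

lemma orlicz_heart_add:
  assumes X: "X \<in> orlicz_heart P \<Psi>" and Y: "Y \<in> orlicz_heart P \<Psi>"
  shows "(\<lambda>\<omega>. X \<omega> + Y \<omega>) \<in> orlicz_heart P \<Psi>"
  unfolding orlicz_heart_iff
proof (intro conjI allI)
  have [measurable]: "X \<in> borel_measurable P" "Y \<in> borel_measurable P"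
    using X Y by (auto simp: orlicz_heart_iff)
  show "(\<lambda>\<omega>. X \<omega> + Y \<omega>) \<in> borel_measurable P" by simp
  fix c :: real
  have "(\<integral>\<^sup>+\<omega>. ennreal (\<Psi> \<bar>c * (X \<omega> + Y \<omega>)\<bar>) \<partial>P)
     \<le> (\<integral>\<^sup>+\<omega>. ennreal (\<Psi> \<bar>2 * (c * X \<omega>)\<bar>) + ennreal (\<Psi> \<bar>2 * (c * Y \<omega>)\<bar>) \<partial>P)"
  proof (rule nn_integral_mono)
    fix \<omega>
    have "\<Psi> \<bar>c * (X \<omega> + Y \<omega>)\<bar> \<le> \<Psi> \<bar>2 * (c * X \<omega>)\<bar> + \<Psi> \<bar>2 * (c * Y \<omega>)\<bar>"
      by (rule le_sum_of_twice) (simp add: distrib_left abs_triangle_ineq)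
    then show "ennreal (\<Psi> \<bar>c * (X \<omega> + Y \<omega>)\<bar>) \<le> ennreal (\<Psi> \<bar>2 * (c * X \<omega>)\<bar>) + ennreal (\<Psi> \<bar>2 * (c * Y \<omega>)\<bar>)"
      by (subst ennreal_plus[symmetric]) (auto intro: nonneg ennreal_leI)
  qed
  also have "\<dots> = (\<integral>\<^sup>+\<omega>. ennreal (\<Psi> \<bar>2 * (c * X \<omega>)\<bar>) \<partial>P) + (\<integral>\<^sup>+\<omega>. ennreal (\<Psi> \<bar>2 * (c * Y \<omega>)\<bar>) \<partial>P)"
    by (rule nn_integral_add) simp_all
  also have "\<dots> < \<infinity>"
    using orlicz_heart_iff[of X P] orlicz_heart_iff[of Y P] X Y by (simp flip: mult.assoc)
  finally show "(\<integral>\<^sup>+\<omega>. ennreal (\<Psi> \<bar>c * (X \<omega> + Y \<omega>)\<bar>) \<partial>P) < \<infinity>" .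
qed

lemma orlicz_heart_diff:
  assumes "X \<in> orlicz_heart P \<Psi>" "Y \<in> orlicz_heart P \<Psi>"
  shows "(\<lambda>\<omega>. X \<omega> - Y \<omega>) \<in> orlicz_heart P \<Psi>"
  using orlicz_heart_add[OF assms(1) orlicz_heart_scale[OF assms(2), of "-1"]] by simp

text \<open>The weight is \<open>i + 1\<close> in the majorant but \<open>(i + 1)\<^sup>2\<close> in
  the hypothesis. The square eventually outruns every fixed multiple of \<open>i + 1\<close>, which
  makes \<open>W\<close> integrable at all scales at once.\<close>

lemma orlicz_heart_majorant:
  assumes Z: "\<And>i::nat. Z i \<in> orlicz_heart P \<Psi>"
    and fast: "\<And>i. (\<integral>\<^sup>+\<omega>. ennreal (\<Psi> \<bar>real ((i + 1)\<^sup>2) * Z i \<omega>\<bar>) \<partial>P) \<le> ennreal ((1/2) ^ i)"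
  obtains W where "W \<in> orlicz_heart P \<Psi>" and "AE \<omega> in P. \<forall>i. real (i + 1) * \<bar>Z i \<omega>\<bar> \<le> W \<omega>"
proof -
  have [measurable]: "Z i \<in> borel_measurable P" for i using Z[of i] by (simp add: orlicz_heart_iff)
  \<comment> \<open>Taken in the extended reals, since the supremum may be infinite on a null set;
    there \<open>W\<close> is 0, the value of \<open>real_of_ereal\<close> at infinity.\<close>
  define s where "s \<omega> = (SUP i. ereal (real (i + 1) * \<bar>Z i \<omega>\<bar>))" for \<omega>
  define W where "W \<omega> = real_of_ereal (s \<omega>)" for \<omega>
  have [measurable]: "s \<in> borel_measurable P" unfolding s_def[abs_def] by measurable
  have Wm[measurable]: "W \<in> borel_measurable P" unfolding W_def[abs_def] by measurable
  have geo: "(\<Sum>i. ennreal ((1/2) ^ i)) < \<infinity>"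
  proof -
    have "summable (\<lambda>i. (1/2::real) ^ i)" by (rule summable_geometric) simp
    then have "(\<Sum>i. ennreal ((1/2) ^ i)) = ennreal (\<Sum>i. (1/2) ^ i)"
      by (intro suminf_ennreal2) auto
    then show ?thesis by simp
  qed
  have "(\<integral>\<^sup>+\<omega>. (\<Sum>i. ennreal (\<Psi> \<bar>real ((i + 1)\<^sup>2) * Z i \<omega>\<bar>)) \<partial>P)
      = (\<Sum>i. \<integral>\<^sup>+\<omega>. ennreal (\<Psi> \<bar>real ((i + 1)\<^sup>2) * Z i \<omega>\<bar>) \<partial>P)"
    by (rule nn_integral_suminf) measurable
  also have "\<dots> \<le> (\<Sum>i. ennreal ((1/2) ^ i))" using fast by (intro suminf_le) auto
  finally have "(\<integral>\<^sup>+\<omega>. (\<Sum>i. ennreal (\<Psi> \<bar>real ((i + 1)\<^sup>2) * Z i \<omega>\<bar>)) \<partial>P) \<noteq> \<infinity>"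
    using geo by (auto simp: top_unique)
  then have "AE \<omega> in P. (\<Sum>i. ennreal (\<Psi> \<bar>real ((i + 1)\<^sup>2) * Z i \<omega>\<bar>)) \<noteq> \<infinity>"
    by (intro nn_integral_PInf_AE) measurable
  then have fin: "AE \<omega> in P. s \<omega> = ereal (W \<omega>)"
  proof eventually_elim
    case (elim \<omega>)
    then obtain y where y: "(\<Sum>i. ennreal (\<Psi> \<bar>real ((i + 1)\<^sup>2) * Z i \<omega>\<bar>)) = ennreal y" "y \<ge> 0"
      by (cases "\<Sum>i. ennreal (\<Psi> \<bar>real ((i + 1)\<^sup>2) * Z i \<omega>\<bar>)") auto
    \<comment> \<open>A finite sum bounds every term, and a bound on \<Psi> bounds its argument
      because \<Psi> tends to infinity.\<close>
    obtain B where B: "B \<ge> 0" "\<And>x. 0 \<le> x \<Longrightarrow> \<Psi> x \<le> y \<Longrightarrow> x \<le> B" using exceeds[of y] by blast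
    have "real (i + 1) * \<bar>Z i \<omega>\<bar> \<le> B" for i
    proof -
      have "ennreal (\<Psi> \<bar>real ((i + 1)\<^sup>2) * Z i \<omega>\<bar>) \<le> ennreal y"
        unfolding y(1)[symmetric] using sum_le_suminf[of "\<lambda>i. ennreal (\<Psi> \<bar>real ((i + 1)\<^sup>2) * Z i \<omega>\<bar>)" "{i}"]
        by simp
      then have "\<Psi> \<bar>real ((i + 1)\<^sup>2) * Z i \<omega>\<bar> \<le> y" using y(2) by simp
      then have "\<bar>real ((i + 1)\<^sup>2) * Z i \<omega>\<bar> \<le> B" using B(2) by simp
      moreover have "real (i + 1) * \<bar>Z i \<omega>\<bar> \<le> real ((i + 1)\<^sup>2) * \<bar>Z i \<omega>\<bar>"
        by (intro mult_right_mono) (auto simp: power2_eq_square)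
      ultimately show ?thesis by (simp add: abs_mult)
    qed
    then have "s \<omega> \<le> ereal B" unfolding s_def by (intro SUP_least) simp
    moreover have "0 \<le> s \<omega>" unfolding s_def by (rule SUP_upper2[of 0]) auto
    ultimately show ?case unfolding W_def by (cases "s \<omega>") auto
  qed
  have dom: "AE \<omega> in P. \<forall>i. real (i + 1) * \<bar>Z i \<omega>\<bar> \<le> W \<omega>"
    using fin
  proof eventually_elim
    case (elim \<omega>)
    show ?case
    proof
      fix i
      have "ereal (real (i + 1) * \<bar>Z i \<omega>\<bar>) \<le> s \<omega>" unfolding s_def by (rule SUP_upper) simp
      then show "real (i + 1) * \<bar>Z i \<omega>\<bar> \<le> W \<omega>" unfolding elim by simp
    qed
  qed
  have "W \<in> orlicz_heart P \<Psi>"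
  proof (rule orlicz_heart_of_nat)
    fix k :: nat
    let ?a = "\<lambda>i. \<integral>\<^sup>+\<omega>. ennreal (\<Psi> \<bar>(2 * k * (i + 1)) * Z i \<omega>\<bar>) \<partial>P"
    have "(\<integral>\<^sup>+\<omega>. ennreal (\<Psi> \<bar>k * W \<omega>\<bar>) \<partial>P) \<le> (\<integral>\<^sup>+\<omega>. (\<Sum>i. ennreal (\<Psi> \<bar>(2 * k * (i + 1)) * Z i \<omega>\<bar>)) \<partial>P)"
    proof (rule nn_integral_mono_AE, use fin in eventually_elim)
      case (elim \<omega>)
      have W0: "0 \<le> W \<omega>"
        using SUP_upper2[of 0 UNIV 0 "\<lambda>i. ereal (real (i + 1) * \<bar>Z i \<omega>\<bar>)"] elim unfolding s_def by simp
      \<comment> \<open>The supremum need not be attained, but half of a positive one is exceeded by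
        some term; hence the 2 in the scale \<open>2 * k * (i + 1)\<close>.\<close>
      have "\<exists>i. W \<omega> \<le> 2 * (real (i + 1) * \<bar>Z i \<omega>\<bar>)"
      proof (cases "W \<omega> = 0")
        case False
        then have "ereal (W \<omega> / 2) < s \<omega>" unfolding elim using W0 by simp
        then obtain i where "W \<omega> / 2 < real (i + 1) * \<bar>Z i \<omega>\<bar>"
          unfolding s_def less_SUP_iff by auto
        then show ?thesis by (intro exI[of _ i]) simp
      qed simp
      then obtain i where i: "W \<omega> \<le> 2 * (real (i + 1) * \<bar>Z i \<omega>\<bar>)" by blast
      have "\<Psi> \<bar>k * W \<omega>\<bar> \<le> \<Psi> \<bar>(2 * k * (i + 1)) * Z i \<omega>\<bar>"
        using mult_left_mono[OF i, of "real k"] W0 by (intro mono_abs) (simp add: abs_mult algebra_simps)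
      then have "ennreal (\<Psi> \<bar>k * W \<omega>\<bar>) \<le> ennreal (\<Psi> \<bar>(2 * k * (i + 1)) * Z i \<omega>\<bar>)" by (rule ennreal_leI)
      also have "\<dots> \<le> (\<Sum>i. ennreal (\<Psi> \<bar>(2 * k * (i + 1)) * Z i \<omega>\<bar>))"
        using sum_le_suminf[of "\<lambda>i. ennreal (\<Psi> \<bar>(2 * k * (i + 1)) * Z i \<omega>\<bar>)" "{i}"] by simp
      finally show ?case .
    qed
    also have "\<dots> = (\<Sum>i. ?a i)" by (rule nn_integral_suminf) measurable
    \<comment> \<open>From \<open>i = 2 * k\<close> on, \<open>2 * k * (i + 1)\<close> is at most
      \<open>(i + 1)\<^sup>2\<close> and the geometric bound applies. The earlier terms are finitely
      many, each finite because \<open>Z i\<close> is in the heart.\<close>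
    also have "\<dots> \<le> (\<Sum>i. (if i \<in> {..<2 * k} then ?a i else 0) + ennreal ((1/2) ^ i))"
    proof (rule suminf_le)
      fix i
      show "?a i \<le> (if i \<in> {..<2 * k} then ?a i else 0) + ennreal ((1/2) ^ i)"
      proof (cases "i < 2 * k")
        case False
        have "?a i \<le> (\<integral>\<^sup>+\<omega>. ennreal (\<Psi> \<bar>real ((i + 1)\<^sup>2) * Z i \<omega>\<bar>) \<partial>P)"
        proof (intro nn_integral_mono ennreal_leI mono_abs)
          fix \<omega>
          have "real (2 * k * (i + 1)) \<le> real ((i + 1)\<^sup>2)"
            unfolding of_nat_le_iff power2_eq_square using False by (intro mult_right_mono) auto
          from mult_right_mono[OF this abs_ge_zero[of "Z i \<omega>"]]
          show "\<bar>(2 * k * (i + 1)) * Z i \<omega>\<bar> \<le> \<bar>real ((i + 1)\<^sup>2) * Z i \<omega>\<bar>"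
            by (simp add: abs_mult)
        qed
        from order.trans[OF this fast[of i]] show ?thesis using False by simp
      qed simp
    qed auto
    also have "\<dots> = (\<Sum>i. if i \<in> {..<2 * k} then ?a i else 0) + (\<Sum>i. ennreal ((1/2) ^ i))"
      by (rule suminf_add[symmetric]) auto
    also have "(\<Sum>i. if i \<in> {..<2 * k} then ?a i else 0) = (\<Sum>i\<in>{..<2 * k}. ?a i)"
      by (subst suminf_finite[of "{..<2 * k}"]) auto
    also have "\<dots> + (\<Sum>i. ennreal ((1/2) ^ i)) < \<infinity>"
    proof -
      have "?a i < \<infinity>" for i using Z[of i] unfolding orlicz_heart_iff by blast
      then have "(\<Sum>i\<in>{..<2 * k}. ?a i) < \<infinity>" by simp
      then show ?thesis using geo by simp
    qed
    finally show "(\<integral>\<^sup>+\<omega>. ennreal (\<Psi> \<bar>k * W \<omega>\<bar>) \<partial>P) < \<infinity>" .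
  qed simp
  then show ?thesis using that dom by blast
qed

end

section \<open>Convex risk measures along sequences in the heart\<close>

locale orlicz_risk_measure = young_function +
  fixes P :: "'a measure" and \<rho> :: "('a \<Rightarrow> real) \<Rightarrow> real" and R :: "real measure \<Rightarrow> real"
  assumes atomless: "atomless_prob_space P"
    and risk: "law_invariant_convex_risk_measure P \<Psi> \<rho>"
    and functional: "is_risk_functional P \<Psi> \<rho> R"
begin

sublocale prob_space P
  using atomless by (simp add: atomless_prob_space_def)

lemma antimono:
  "X \<in> orlicz_heart P \<Psi> \<Longrightarrow> Y \<in> orlicz_heart P \<Psi> \<Longrightarrow> (AE \<omega> in P. X \<omega> \<le> Y \<omega>) \<Longrightarrow> \<rho> Y \<le> \<rho> X"
  using risk unfolding law_invariant_convex_risk_measure_def by blast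

lemma convex:
  "X \<in> orlicz_heart P \<Psi> \<Longrightarrow> Y \<in> orlicz_heart P \<Psi> \<Longrightarrow> 0 \<le> t \<Longrightarrow> t \<le> 1 \<Longrightarrow>
     \<rho> (\<lambda>\<omega>. t * X \<omega> + (1 - t) * Y \<omega>) \<le> t * \<rho> X + (1 - t) * \<rho> Y"
  using risk[unfolded law_invariant_convex_risk_measure_def, THEN conjunct2, THEN conjunct1,
      rule_format, of X Y t] by simp

lemma R_distr: "X \<in> orlicz_heart P \<Psi> \<Longrightarrow> R (distr P borel X) = \<rho> X"
  using functional by (simp add: is_risk_functional_def)

text \<open>Convexity along the segments from \<open>X\<close> through \<open>Y i\<close> and from \<open>Y i\<close> through \<open>X\<close>, extended by
  the factor \<open>i + 1\<close>: monotonicity bounds \<open>\<rho>\<close> at the far ends by \<open>\<rho> (X - W)\<close>.\<close>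

lemma rho_tendsto_fast:
  assumes X: "X \<in> orlicz_heart P \<Psi>" and Y: "\<And>i::nat. Y i \<in> orlicz_heart P \<Psi>"
    and fast: "\<And>i. (\<integral>\<^sup>+\<omega>. ennreal (\<Psi> \<bar>real ((i + 1)\<^sup>2) * (Y i \<omega> - X \<omega>)\<bar>) \<partial>P) \<le> ennreal ((1/2) ^ i)"
  shows "(\<lambda>i. \<rho> (Y i)) \<longlonglongrightarrow> \<rho> X"
proof -
  obtain W where W: "W \<in> orlicz_heart P \<Psi>"
    and dom: "AE \<omega> in P. \<forall>i. real (i + 1) * \<bar>Y i \<omega> - X \<omega>\<bar> \<le> W \<omega>"
    using orlicz_heart_majorant[of "\<lambda>i \<omega>. Y i \<omega> - X \<omega>" P, OF orlicz_heart_diff[OF Y X] fast] by blast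
  define r where "r = \<rho> (\<lambda>\<omega>. X \<omega> - W \<omega>)"
  have XW: "(\<lambda>\<omega>. X \<omega> - W \<omega>) \<in> orlicz_heart P \<Psi>" by (rule orlicz_heart_diff[OF X W])
  have far: "(\<lambda>\<omega>. X \<omega> + a * (Y i \<omega> - X \<omega>)) \<in> orlicz_heart P \<Psi> \<and> \<rho> (\<lambda>\<omega>. X \<omega> + a * (Y i \<omega> - X \<omega>)) \<le> r"
    if "\<bar>a\<bar> = real (i + 1)" for a i
  proof
    show H: "(\<lambda>\<omega>. X \<omega> + a * (Y i \<omega> - X \<omega>)) \<in> orlicz_heart P \<Psi>"
      by (intro orlicz_heart_add orlicz_heart_scale orlicz_heart_diff X Y)
    have "AE \<omega> in P. X \<omega> - W \<omega> \<le> X \<omega> + a * (Y i \<omega> - X \<omega>)"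
      using dom
    proof eventually_elim
      case (elim \<omega>)
      have "\<bar>a * (Y i \<omega> - X \<omega>)\<bar> \<le> W \<omega>" using elim that by (simp add: abs_mult)
      then show ?case by linarith
    qed
    then show "\<rho> (\<lambda>\<omega>. X \<omega> + a * (Y i \<omega> - X \<omega>)) \<le> r" unfolding r_def by (rule antimono[OF XW H])
  qed
  have upper: "\<rho> (Y i) \<le> \<rho> X + (r - \<rho> X) / real (i + 1)" for i
  proof -
    define t where "t = 1 / real (i + 1)"
    have t: "0 \<le> t" "t \<le> 1" "t * real (i + 1) = 1" by (auto simp: t_def)
    let ?V = "\<lambda>\<omega>. X \<omega> + real (i + 1) * (Y i \<omega> - X \<omega>)"
    have "t * ?V \<omega> + (1 - t) * X \<omega> = Y i \<omega>" for \<omega>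
    proof -
      have "t * ?V \<omega> + (1 - t) * X \<omega> = (t * real (i + 1)) * (Y i \<omega> - X \<omega>) + X \<omega>"
        by (simp only: algebra_simps)
      then show ?thesis unfolding t by simp
    qed
    then have "\<rho> (Y i) \<le> t * \<rho> ?V + (1 - t) * \<rho> X"
      using convex[of ?V X t] far[of "real (i + 1)" i] X t by simp
    also have "\<dots> \<le> t * r + (1 - t) * \<rho> X"
      using far[of "real (i + 1)" i] t by (intro add_right_mono mult_left_mono) auto
    also have "\<dots> = \<rho> X + (r - \<rho> X) / real (i + 1)"
      by (simp add: t_def left_diff_distrib diff_divide_distrib)
    finally show ?thesis .
  qed
  have lower: "\<rho> X + (\<rho> X - r) / real (i + 1) \<le> \<rho> (Y i)" for i
  proof -
    \<comment> \<open>Seen from \<open>X\<close>, the point \<open>?V\<close> lies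
      \<open>i + 1\<close> steps on the side opposite to \<open>Y i\<close>, which is one step away;
      so \<open>X\<close> is their mixture with weight \<open>1 / (i + 2)\<close> on
      \<open>?V\<close>.\<close>
    define t where "t = 1 / (real (i + 1) + 1)"
    have t: "0 \<le> t" "t \<le> 1" "t * (real (i + 1) + 1) = 1" by (auto simp: t_def)
    let ?V = "\<lambda>\<omega>. X \<omega> + - real (i + 1) * (Y i \<omega> - X \<omega>)"
    have "t * ?V \<omega> + (1 - t) * Y i \<omega> = X \<omega>" for \<omega>
    proof -
      have "t * ?V \<omega> + (1 - t) * Y i \<omega> = (t * (real (i + 1) + 1)) * (X \<omega> - Y i \<omega>) + Y i \<omega>"
        by (simp only: algebra_simps)
      then show ?thesis unfolding t by simp
    qed
    then have "\<rho> X \<le> t * \<rho> ?V + (1 - t) * \<rho> (Y i)"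
      using convex[of ?V "Y i" t] far[of "- real (i + 1)" i] Y t by simp
    also have "\<dots> \<le> t * r + (1 - t) * \<rho> (Y i)"
      using far[of "- real (i + 1)" i] t by (intro add_right_mono mult_left_mono) auto
    finally have "(real (i + 1) + 1) * \<rho> X \<le> (real (i + 1) + 1) * (t * r + (1 - t) * \<rho> (Y i))"
      by (rule mult_left_mono) simp
    also have "\<dots> = (t * (real (i + 1) + 1)) * (r - \<rho> (Y i)) + (real (i + 1) + 1) * \<rho> (Y i)"
      by (simp only: algebra_simps)
    finally have "\<rho> X * real (i + 1) + (\<rho> X - r) \<le> \<rho> (Y i) * real (i + 1)"
      unfolding t by (simp add: algebra_simps)
    then show ?thesis by (simp add: field_simps)
  qed
  have lim: "(\<lambda>i. \<rho> X + a / real (i + 1)) \<longlonglongrightarrow> \<rho> X" for a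
    using tendsto_add[OF tendsto_const LIMSEQ_Suc[OF lim_const_over_n[of a]], of "\<rho> X"] by simp
  show ?thesis
    by (rule tendsto_sandwich[OF always_eventually always_eventually lim lim]) (rule allI, rule lower, rule allI, rule upper)
qed

text \<open>Otherwise infinitely many indices stay away from \<open>\<rho> X\<close>, and among them
  the integrals become small enough to pick a sequence for \<open>rho_tendsto_fast\<close>. The
  picked indices \<open>j i\<close> need not increase.\<close>

lemma rho_tendsto:
  assumes X: "X \<in> orlicz_heart P \<Psi>" and Y: "\<And>j::nat. Y j \<in> orlicz_heart P \<Psi>"
    and lim: "\<And>k::nat. (\<lambda>j. \<integral>\<^sup>+\<omega>. ennreal (\<Psi> \<bar>real k * (Y j \<omega> - X \<omega>)\<bar>) \<partial>P) \<longlonglongrightarrow> 0"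
  shows "(\<lambda>j. \<rho> (Y j)) \<longlonglongrightarrow> \<rho> X"
proof (rule tendstoI, rule ccontr)
  fix e :: real assume e: "e > 0" and "\<not> (\<forall>\<^sub>F j in sequentially. dist (\<rho> (Y j)) (\<rho> X) < e)"
  then have freq: "\<exists>\<^sub>F j in sequentially. \<not> dist (\<rho> (Y j)) (\<rho> X) < e" by (simp add: frequently_def)
  have "\<exists>j. \<not> dist (\<rho> (Y j)) (\<rho> X) < e \<and>
     (\<integral>\<^sup>+\<omega>. ennreal (\<Psi> \<bar>real ((i + 1)\<^sup>2) * (Y j \<omega> - X \<omega>)\<bar>) \<partial>P) \<le> ennreal ((1/2) ^ i)" for i
  proof -
    have "(0::ennreal) < ennreal ((1/2) ^ i)" by simp
    from order_tendstoD(2)[OF lim[of "(i + 1)\<^sup>2"] this]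
    have "\<exists>\<^sub>F j in sequentially. \<not> dist (\<rho> (Y j)) (\<rho> X) < e \<and>
       (\<integral>\<^sup>+\<omega>. ennreal (\<Psi> \<bar>real ((i + 1)\<^sup>2) * (Y j \<omega> - X \<omega>)\<bar>) \<partial>P) < ennreal ((1/2) ^ i)"
      by (rule frequently_eventually_frequently[OF freq])
    from frequently_ex[OF this] show ?thesis by (auto intro: less_imp_le)
  qed
  then obtain j where j: "\<And>i. \<not> dist (\<rho> (Y (j i))) (\<rho> X) < e"
     "\<And>i. (\<integral>\<^sup>+\<omega>. ennreal (\<Psi> \<bar>real ((i + 1)\<^sup>2) * (Y (j i) \<omega> - X \<omega>)\<bar>) \<partial>P) \<le> ennreal ((1/2) ^ i)"
    by metis
  have "(\<lambda>i. \<rho> (Y (j i))) \<longlonglongrightarrow> \<rho> X" by (rule rho_tendsto_fast[OF X Y j(2)])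
  then have "\<forall>\<^sub>F i in sequentially. dist (\<rho> (Y (j i))) (\<rho> X) < e" using e by (rule tendstoD)
  then show False using j(1) by simp
qed

end

section \<open>Risk functionals and weak convergence\<close>

text \<open>Natural scales are cofinal among all positive ones, and being enumerated they can be
  imposed finitely many at a time. The cut is made in \<open>x\<close> rather than in the value of
  \<Psi>, so that one threshold makes the remaining region bounded. Values in \<open>ennreal\<close>
  allow the integral to be infinite.\<close>

definition tail_integral :: "(real \<Rightarrow> real) \<Rightarrow> nat \<Rightarrow> real \<Rightarrow> real measure \<Rightarrow> ennreal" where
  "tail_integral \<Psi> k a \<mu> = (\<integral>\<^sup>+x. ennreal (\<Psi> \<bar>real k * x\<bar>) * indicator {x. a < \<bar>x\<bar>} x \<partial>\<mu>)"

context young_function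
begin

lemma tail_integral_antimono: "a \<le> b \<Longrightarrow> tail_integral \<Psi> k b \<mu> \<le> tail_integral \<Psi> k a \<mu>"
  unfolding tail_integral_def by (intro nn_integral_mono mult_left_mono) (auto split: split_indicator)

lemma tail_integral_mono: "k \<le> l \<Longrightarrow> tail_integral \<Psi> k a \<mu> \<le> tail_integral \<Psi> l a \<mu>"
  unfolding tail_integral_def
  by (intro nn_integral_mono mult_right_mono ennreal_leI mono_abs) (auto simp: abs_mult mult_right_mono)

lemma tail_integral_tendsto:
  assumes [measurable_cong]: "sets \<mu> = sets borel" and fin: "(\<integral>\<^sup>+x. ennreal (\<Psi> \<bar>real k * x\<bar>) \<partial>\<mu>) < \<infinity>"
  shows "((\<lambda>n. tail_integral \<Psi> k (real n) \<mu>) \<longlonglongrightarrow> 0)"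
proof -
  have "(\<lambda>n. \<integral>\<^sup>+x. ennreal (\<Psi> \<bar>real k * x\<bar>) * indicator {x. real n < \<bar>x\<bar>} x \<partial>\<mu>) \<longlonglongrightarrow> (\<integral>\<^sup>+x. 0 \<partial>\<mu>)"
  proof (rule nn_integral_dominated_convergence[where w="\<lambda>x. ennreal (\<Psi> \<bar>real k * x\<bar>)"])
    show "AE x in \<mu>. (\<lambda>n. ennreal (\<Psi> \<bar>real k * x\<bar>) * indicator {x. real n < \<bar>x\<bar>} x) \<longlonglongrightarrow> 0"
    proof (rule AE_I2)
      fix x :: real
      obtain N :: nat where N: "\<bar>x\<bar> \<le> real N" using real_arch_simple by blast
      have "\<forall>\<^sub>F n in sequentially. ennreal (\<Psi> \<bar>real k * x\<bar>) * indicator {x. real n < \<bar>x\<bar>} x = 0"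
        using eventually_ge_at_top[of N] by eventually_elim (use N in auto)
      then show "(\<lambda>n. ennreal (\<Psi> \<bar>real k * x\<bar>) * indicator {x. real n < \<bar>x\<bar>} x) \<longlonglongrightarrow> 0"
        by (rule tendsto_eventually)
    qed
    show "AE x in \<mu>. ennreal (\<Psi> \<bar>real k * x\<bar>) * indicator {x. real n < \<bar>x\<bar>} x \<le> ennreal (\<Psi> \<bar>real k * x\<bar>)" for n
      by (auto split: split_indicator)
  qed (use fin in \<open>simp_all, measurable\<close>)
  then show ?thesis by (simp add: tail_integral_def)
qed

lemma tail_integral_small:
  assumes "sets \<mu> = sets borel" "(\<integral>\<^sup>+x. ennreal (\<Psi> \<bar>real k * x\<bar>) \<partial>\<mu>) < \<infinity>" and "e > 0"
  shows "\<exists>a. tail_integral \<Psi> k a \<mu> \<le> ennreal e"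
proof -
  have "\<forall>\<^sub>F n in sequentially. tail_integral \<Psi> k (real n) \<mu> < ennreal e"
    using \<open>e > 0\<close> by (intro order_tendstoD(2)[OF tail_integral_tendsto[OF assms(1,2)]]) simp
  from eventually_happens'[OF sequentially_bot this] show ?thesis by (auto intro: less_imp_le)
qed

end

context orlicz_risk_measure
begin

lemma nn_integral_law:
  assumes "X \<in> borel_measurable P"
  shows "(\<integral>\<^sup>+x. ennreal (\<Psi> \<bar>c * x\<bar>) \<partial>distr P borel X) = (\<integral>\<^sup>+\<omega>. ennreal (\<Psi> \<bar>c * X \<omega>\<bar>) \<partial>P)"
  by (rule nn_integral_distr[OF assms]) simp

lemma orlicz_heart_laws_iff:
  "\<mu> \<in> orlicz_heart_laws P \<Psi> \<longleftrightarrow>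
     real_distribution \<mu> \<and> (\<forall>k::nat. (\<integral>\<^sup>+x. ennreal (\<Psi> \<bar>real k * x\<bar>) \<partial>\<mu>) < \<infinity>)"
proof
  assume "\<mu> \<in> orlicz_heart_laws P \<Psi>"
  then obtain X where X: "X \<in> orlicz_heart P \<Psi>" "\<mu> = distr P borel X" by (auto simp: orlicz_heart_laws_def)
  then have m: "X \<in> borel_measurable P" by (simp add: orlicz_heart_iff)
  then show "real_distribution \<mu> \<and> (\<forall>k::nat. (\<integral>\<^sup>+x. ennreal (\<Psi> \<bar>real k * x\<bar>) \<partial>\<mu>) < \<infinity>)"
    using X unfolding X(2) nn_integral_law[OF m] orlicz_heart_iff by simp
next
  assume \<mu>: "real_distribution \<mu> \<and> (\<forall>k::nat. (\<integral>\<^sup>+x. ennreal (\<Psi> \<bar>real k * x\<bar>) \<partial>\<mu>) < \<infinity>)"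
  obtain U where U[measurable]: "U \<in> borel_measurable P"
    and dU: "distr P borel U = distr unit_uniform borel (\<lambda>x. x)"
    using atomless_uniform[OF atomless] by blast
  have [measurable]: "quantile \<mu> \<in> borel_measurable borel" using \<mu> quantile_measurable by blast
  have d: "distr P borel (\<lambda>\<omega>. quantile \<mu> (U \<omega>)) = \<mu>" using \<mu> distr_quantile[OF _ U dU] by blast
  have "(\<lambda>\<omega>. quantile \<mu> (U \<omega>)) \<in> orlicz_heart P \<Psi>"
  proof (rule orlicz_heart_of_nat)
    show m: "(\<lambda>\<omega>. quantile \<mu> (U \<omega>)) \<in> borel_measurable P" by simp
    show "(\<integral>\<^sup>+\<omega>. ennreal (\<Psi> \<bar>real k * quantile \<mu> (U \<omega>)\<bar>) \<partial>P) < \<infinity>" for k :: nat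
      unfolding nn_integral_law[OF m, symmetric] d using \<mu> by blast
  qed
  then show "\<mu> \<in> orlicz_heart_laws P \<Psi>"
    unfolding orlicz_heart_laws_def using d by force
qed

lemma orlicz_heartI_law:
  assumes "X \<in> borel_measurable P" "distr P borel X \<in> orlicz_heart_laws P \<Psi>"
  shows "X \<in> orlicz_heart P \<Psi>"
  using assms nn_integral_law[OF assms(1)] by (intro orlicz_heart_of_nat) (simp_all add: orlicz_heart_laws_iff)

text \<open>After coupling on \<open>P\<close>, only the tails can prevent almost sure convergence
  from being convergence in the heart. The tail hypothesis concerns laws alone, so it survives the
  passage to the coupled variables.\<close>

lemma R_tendsto:
  assumes \<nu>: "\<And>j::nat. \<nu> j \<in> orlicz_heart_laws P \<Psi>" and \<mu>: "\<mu> \<in> orlicz_heart_laws P \<Psi>"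
    and conv: "weak_conv_m \<nu> \<mu>"
    and tails: "\<And>k e. e > 0 \<Longrightarrow> \<exists>a. \<forall>\<^sub>F j in sequentially. tail_integral \<Psi> k a (\<nu> j) \<le> ennreal e"
  shows "(\<lambda>j. R (\<nu> j)) \<longlonglongrightarrow> R \<mu>"
proof -
  have rd: "real_distribution (\<nu> j)" "real_distribution \<mu>" for j
    using \<nu>[of j] \<mu> by (auto simp: orlicz_heart_laws_iff)
  obtain Y X where Y[measurable]: "\<And>n. Y n \<in> borel_measurable P" and dY: "\<And>n. distr P borel (Y n) = \<nu> n"
    and X[measurable]: "X \<in> borel_measurable P" and dX: "distr P borel X = \<mu>"
    and lim: "AE \<omega> in P. (\<lambda>n. Y n \<omega>) \<longlonglongrightarrow> X \<omega>"
    using skorohod_on_atomless[OF atomless rd conv] by blast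
  have heart: "X \<in> orlicz_heart P \<Psi>" "Y j \<in> orlicz_heart P \<Psi>" for j
    using orlicz_heartI_law[OF X] orlicz_heartI_law[OF Y] dX dY \<mu> \<nu> by auto
  have "(\<lambda>j. \<rho> (Y j)) \<longlonglongrightarrow> \<rho> X"
  proof (rule rho_tendsto[OF heart])
    fix k :: nat
    show "(\<lambda>j. \<integral>\<^sup>+\<omega>. ennreal (\<Psi> \<bar>real k * (Y j \<omega> - X \<omega>)\<bar>) \<partial>P) \<longlonglongrightarrow> 0"
    proof (rule ennreal_tendsto_0I)
      fix e :: real assume "e > 0"
      then have e3: "e / 3 > 0" by simp
      \<comment> \<open>The scale is doubled because
        \<open>\<bar>Y j \<omega> - X \<omega>\<bar>\<close> is at most twice the larger of the two
        absolute values; off the bounded region the tail of that larger variable takes the whole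
        integrand.\<close>
      obtain a1 where a1: "\<forall>\<^sub>F j in sequentially. tail_integral \<Psi> (2 * k) a1 (\<nu> j) \<le> ennreal (e / 3)"
        using tails[OF e3] by blast
      obtain a2 where a2: "tail_integral \<Psi> (2 * k) a2 \<mu> \<le> ennreal (e / 3)"
        using tail_integral_small[of \<mu> "2 * k", OF _ _ e3] \<mu> real_distribution.events_eq_borel[OF rd(2)]
        unfolding orlicz_heart_laws_iff by blast
      define a where "a = max a1 a2"
      \<comment> \<open>Where neither variable exceeds \<open>a\<close> the integrand is at most a
        constant, integrable on a probability space, so dominated convergence applies.\<close>
      let ?core = "\<lambda>j \<omega>. ennreal (\<Psi> \<bar>real k * (Y j \<omega> - X \<omega>)\<bar>) * indicator {\<omega>. \<bar>Y j \<omega>\<bar> \<le> a \<and> \<bar>X \<omega>\<bar> \<le> a} \<omega>"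
      have "(\<lambda>j. \<integral>\<^sup>+\<omega>. ?core j \<omega> \<partial>P) \<longlonglongrightarrow> (\<integral>\<^sup>+\<omega>. 0 \<partial>P)"
      proof (rule nn_integral_dominated_convergence[where w="\<lambda>\<omega>. ennreal (\<Psi> \<bar>real k * (2 * a)\<bar>)"])
        show "AE \<omega> in P. ?core j \<omega> \<le> ennreal (\<Psi> \<bar>real k * (2 * a)\<bar>)" for j
        proof (rule AE_I2)
          fix \<omega>
          show "?core j \<omega> \<le> ennreal (\<Psi> \<bar>real k * (2 * a)\<bar>)"
          proof (cases "\<bar>Y j \<omega>\<bar> \<le> a \<and> \<bar>X \<omega>\<bar> \<le> a")
            case True
            then have "\<bar>real k * (Y j \<omega> - X \<omega>)\<bar> \<le> \<bar>real k * (2 * a)\<bar>"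
              unfolding abs_mult by (intro mult_left_mono) auto
            then show ?thesis using True by (simp add: ennreal_leI mono_abs)
          qed simp
        qed
        show "AE \<omega> in P. (\<lambda>j. ?core j \<omega>) \<longlonglongrightarrow> 0"
          using lim
        proof eventually_elim
          case (elim \<omega>)
          have "(\<lambda>j. real k * (Y j \<omega> - X \<omega>)) \<longlonglongrightarrow> real k * (X \<omega> - X \<omega>)"
            by (intro tendsto_intros elim)
          from continuous_on_tendsto_compose[OF continuous_abs this]
          have "(\<lambda>j. ennreal (\<Psi> \<bar>real k * (Y j \<omega> - X \<omega>)\<bar>)) \<longlonglongrightarrow> ennreal 0"
            by (intro tendsto_ennrealI) simp
          then have L: "(\<lambda>j. ennreal (\<Psi> \<bar>real k * (Y j \<omega> - X \<omega>)\<bar>)) \<longlonglongrightarrow> 0" by simp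
          show ?case
            by (rule tendsto_sandwich[OF _ _ tendsto_const L]) (auto split: split_indicator)
        qed
      qed (simp_all add: emeasure_space_1 ennreal_mult_less_top)
      then have c: "\<forall>\<^sub>F j in sequentially. (\<integral>\<^sup>+\<omega>. ?core j \<omega> \<partial>P) < ennreal (e / 3)"
        using e3 by (intro order_tendstoD(2)[of _ 0]) simp_all
      show "\<forall>\<^sub>F j in sequentially. (\<integral>\<^sup>+\<omega>. ennreal (\<Psi> \<bar>real k * (Y j \<omega> - X \<omega>)\<bar>) \<partial>P) \<le> ennreal e"
        using c a1
      proof eventually_elim
        case (elim j)
        let ?t = "\<lambda>Z \<omega>. ennreal (\<Psi> \<bar>real (2 * k) * Z \<omega>\<bar>) * indicator {x. a < \<bar>x\<bar>} (Z \<omega>)"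
        have t: "(\<integral>\<^sup>+\<omega>. ?t Z \<omega> \<partial>P) = tail_integral \<Psi> (2 * k) a (distr P borel Z)"
          if "Z \<in> borel_measurable P" for Z :: "'a \<Rightarrow> real"
          unfolding tail_integral_def by (rule nn_integral_distr[OF that, symmetric]) measurable
        have "(\<integral>\<^sup>+\<omega>. ennreal (\<Psi> \<bar>real k * (Y j \<omega> - X \<omega>)\<bar>) \<partial>P)
            \<le> (\<integral>\<^sup>+\<omega>. ?core j \<omega> + (?t (Y j) \<omega> + ?t X \<omega>) \<partial>P)"
        proof (rule nn_integral_mono)
          fix \<omega>
          consider "\<bar>Y j \<omega>\<bar> \<le> a \<and> \<bar>X \<omega>\<bar> \<le> a" | "a < \<bar>Y j \<omega>\<bar>" "\<bar>X \<omega>\<bar> \<le> \<bar>Y j \<omega>\<bar>"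
            | "a < \<bar>X \<omega>\<bar>" "\<bar>Y j \<omega>\<bar> \<le> \<bar>X \<omega>\<bar>" by linarith
          then show "ennreal (\<Psi> \<bar>real k * (Y j \<omega> - X \<omega>)\<bar>) \<le> ?core j \<omega> + (?t (Y j) \<omega> + ?t X \<omega>)"
          proof cases
            case 2
            then have "\<bar>Y j \<omega> - X \<omega>\<bar> \<le> 2 * \<bar>Y j \<omega>\<bar>" by linarith
            from mult_left_mono[OF this, of "real k"]
            have "\<bar>real k * (Y j \<omega> - X \<omega>)\<bar> \<le> \<bar>real (2 * k) * Y j \<omega>\<bar>"
              by (simp add: abs_mult ac_simps)
            then have "ennreal (\<Psi> \<bar>real k * (Y j \<omega> - X \<omega>)\<bar>) \<le> ?t (Y j) \<omega>"
              using 2 by (simp only: mem_Collect_eq indicator_simps mult_1_right ennreal_leI mono_abs)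
            then show ?thesis by (intro add_increasing add_increasing2) simp_all
          next
            case 3
            then have "\<bar>Y j \<omega> - X \<omega>\<bar> \<le> 2 * \<bar>X \<omega>\<bar>" by linarith
            from mult_left_mono[OF this, of "real k"]
            have "\<bar>real k * (Y j \<omega> - X \<omega>)\<bar> \<le> \<bar>real (2 * k) * X \<omega>\<bar>"
              by (simp add: abs_mult ac_simps)
            then have "ennreal (\<Psi> \<bar>real k * (Y j \<omega> - X \<omega>)\<bar>) \<le> ?t X \<omega>"
              using 3 by (simp only: mem_Collect_eq indicator_simps mult_1_right ennreal_leI mono_abs)
            then show ?thesis by (intro add_increasing) simp_all
          qed (simp add: add_increasing2)
        qed
        also have "\<dots> = (\<integral>\<^sup>+\<omega>. ?core j \<omega> \<partial>P) + ((\<integral>\<^sup>+\<omega>. ?t (Y j) \<omega> \<partial>P) + (\<integral>\<^sup>+\<omega>. ?t X \<omega> \<partial>P))"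
          by (subst nn_integral_add, measurable)+ 
        also have "\<dots> \<le> ennreal (e / 3) + (ennreal (e / 3) + ennreal (e / 3))"
          unfolding t[OF Y] t[OF X] dX dY
        proof (intro add_mono)
          show "tail_integral \<Psi> (2 * k) a (\<nu> j) \<le> ennreal (e / 3)"
            using tail_integral_antimono[of a1 a] elim(2) by (rule order.trans) (simp add: a_def)
          show "tail_integral \<Psi> (2 * k) a \<mu> \<le> ennreal (e / 3)"
            using tail_integral_antimono[of a2 a] a2 by (rule order.trans) (simp add: a_def)
        qed (use elim(1) in simp)
        also have "\<dots> = ennreal e" using e3 by (simp flip: ennreal_plus)
        finally show "(\<integral>\<^sup>+\<omega>. ennreal (\<Psi> \<bar>real k * (Y j \<omega> - X \<omega>)\<bar>) \<partial>P) \<le> ennreal e" .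
      qed
    qed
  qed
  then show ?thesis using R_distr[OF heart(1)] R_distr[OF heart(2)] dX dY by simp
qed

end

section \<open>Weak neighbourhoods and uniform tails\<close>

text \<open>\<open>cts_step\<close> is the ramp falling from 1 to 0 between its two arguments.
  Rational endpoints make the family countable, and the enumeration allows finite subfamilies
  \<open>k < K\<close>. A pair with \<open>p \<ge> q\<close> codes the zero function, which is
  harmless.\<close>

definition step_test :: "nat \<Rightarrow> real \<Rightarrow> real" where
  "step_test n = (case from_nat n :: rat \<times> rat of (p, q) \<Rightarrow>
     if p < q then cts_step (of_rat p) (of_rat q) else (\<lambda>_. 0))"

lemma step_test_eq: "p < q \<Longrightarrow> \<exists>n. step_test n = cts_step (of_rat p) (of_rat q)"
  by (rule exI[of _ "to_nat (p, q)"]) (simp add: step_test_def)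

lemma step_test_bounds: "0 \<le> step_test n x" "step_test n x \<le> 1"
  by (auto simp: step_test_def cts_step_def of_rat_less divide_simps split: prod.split)

lemma step_test_continuous: "continuous_on UNIV (step_test n)"
  by (auto simp: step_test_def of_rat_less split: prod.split
      intro!: uniformly_continuous_imp_continuous cts_step_uniformly_continuous)

lemma step_test_measurable [measurable]: "step_test n \<in> borel_measurable borel"
  by (rule borel_measurable_continuous_onI[OF step_test_continuous])

text \<open>The integral of a ramp from \<open>p\<close> to \<open>q\<close> lies between the
  distribution function at \<open>p\<close> and at \<open>q\<close>. Near a continuity point,
  rational ramps on either side therefore squeeze the distribution functions.\<close>

lemma weak_conv_mI_step_test:
  assumes \<nu>: "\<And>n. real_distribution (\<nu> n)" and \<mu>: "real_distribution \<mu>"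
    and lim: "\<And>k. (\<lambda>n. integral\<^sup>L (\<nu> n) (step_test k)) \<longlonglongrightarrow> integral\<^sup>L \<mu> (step_test k)"
  shows "weak_conv_m \<nu> \<mu>"
  unfolding weak_conv_m_def weak_conv_def
proof (intro allI impI)
  interpret \<nu>: real_distribution "\<nu> n" for n by (rule \<nu>)
  interpret \<mu>: real_distribution \<mu> by (rule \<mu>)
  have between: "\<exists>p q. u < p \<and> p < q \<and> q < v \<and>
      (\<lambda>n. integral\<^sup>L (\<nu> n) (cts_step p q)) \<longlonglongrightarrow> integral\<^sup>L \<mu> (cts_step p q)" if uv: "u < v" for u v
  proof -
    obtain p where p: "u < of_rat p" "of_rat p < v" using of_rat_dense[OF uv] by blast
    obtain q where q: "real_of_rat p < of_rat q" "of_rat q < v" using of_rat_dense[OF p(2)] by blast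
    then show ?thesis using p lim step_test_eq[of p q] by (metis of_rat_less)
  qed
  fix x assume "isCont (cdf \<mu>) x"
  then have lims: "(cdf \<mu> \<longlongrightarrow> cdf \<mu> x) (at_left x)" "(cdf \<mu> \<longlongrightarrow> cdf \<mu> x) (at_right x)"
    by (auto simp: isCont_def filterlim_at_split)
  show "(\<lambda>n. cdf (\<nu> n) x) \<longlonglongrightarrow> cdf \<mu> x"
  proof (rule order_tendstoI)
    fix a assume "a < cdf \<mu> x"
    then have "\<forall>\<^sub>F y in at_left x. a < cdf \<mu> y" by (rule order_tendstoD(1)[OF lims(1)])
    then have "\<forall>\<^sub>F y in at_left x. a < cdf \<mu> y \<and> y < x"
      by (rule eventually_conj) (auto simp: eventually_at_filter)
    then obtain y where y: "a < cdf \<mu> y" "y < x"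
      using eventually_happens'[OF trivial_limit_at_left_real] by blast
    obtain p q where pq: "y < p" "p < q" "q < x"
      and l: "(\<lambda>n. integral\<^sup>L (\<nu> n) (cts_step p q)) \<longlonglongrightarrow> integral\<^sup>L \<mu> (cts_step p q)"
      using between[OF y(2)] by blast
    have "a < integral\<^sup>L \<mu> (cts_step p q)"
      using y(1) \<mu>.cdf_nondecreasing[of y p] \<mu>.cdf_cts_step(1)[OF pq(2)] pq by linarith
    from order_tendstoD(1)[OF l this] show "\<forall>\<^sub>F n in sequentially. a < cdf (\<nu> n) x"
    proof eventually_elim
      case (elim n)
      then show ?case using \<nu>.cdf_cts_step(2)[OF pq(2), of n] \<nu>.cdf_nondecreasing[of q x n] pq by linarith
    qed
  next
    fix a assume "cdf \<mu> x < a"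
    then have "\<forall>\<^sub>F y in at_right x. cdf \<mu> y < a" by (rule order_tendstoD(2)[OF lims(2)])
    then have "\<forall>\<^sub>F y in at_right x. cdf \<mu> y < a \<and> x < y"
      by (rule eventually_conj) (auto simp: eventually_at_filter)
    then obtain y where y: "cdf \<mu> y < a" "x < y"
      using eventually_happens'[OF trivial_limit_at_right_real] by blast
    obtain p q where pq: "x < p" "p < q" "q < y"
      and l: "(\<lambda>n. integral\<^sup>L (\<nu> n) (cts_step p q)) \<longlonglongrightarrow> integral\<^sup>L \<mu> (cts_step p q)"
      using between[OF y(2)] by blast
    have "integral\<^sup>L \<mu> (cts_step p q) < a"
      using y(1) \<mu>.cdf_nondecreasing[of q y] \<mu>.cdf_cts_step(2)[OF pq(2)] pq by linarith
    from order_tendstoD(2)[OF l this] show "\<forall>\<^sub>F n in sequentially. cdf (\<nu> n) x < a"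
    proof eventually_elim
      case (elim n)
      then show ?case using \<nu>.cdf_cts_step(1)[OF pq(2), of n] \<nu>.cdf_nondecreasing[of x p n] pq by linarith
    qed
  qed
qed

text \<open>For fixed \<open>\<mu>\<close> these sets form a countable neighbourhood base, so that neighbourhoods can be
  found by arguing along sequences.\<close>

definition weak_ball :: "nat \<Rightarrow> real measure \<Rightarrow> real measure set" where
  "weak_ball K \<mu> = {\<nu> \<in> space (prob_algebra borel).
     \<forall>k<K. \<bar>integral\<^sup>L \<nu> (step_test k) - integral\<^sup>L \<mu> (step_test k)\<bar> < 1 / real (K + 1)}"

lemma space_prob_algebra_borel_iff: "\<mu> \<in> space (prob_algebra borel) \<longleftrightarrow> real_distribution \<mu>"
  by (auto simp: space_prob_algebra real_distribution_def real_distribution_axioms_def)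

lemma openin_weak_ball: "openin weak_topology (weak_ball K \<mu>)"
proof -
  have basic: "openin weak_topology {\<nu> \<in> space (prob_algebra borel). \<bar>integral\<^sup>L \<nu> (step_test k) - z\<bar> < d}"
    for k z d
    unfolding weak_topology_def
  proof (rule topology_generated_by_Basis, rule CollectI, intro exI conjI)
    show "{\<nu> \<in> space (prob_algebra borel). \<bar>integral\<^sup>L \<nu> (step_test k) - z\<bar> < d} =
      {\<nu> \<in> space (prob_algebra borel). integral\<^sup>L \<nu> (step_test k) \<in> {z - d<..<z + d}}"
      by (auto simp: abs_less_iff)
    show "bounded (range (step_test k))"
      by (rule boundedI[of _ 1]) (use step_test_bounds in auto)
  qed (auto intro: step_test_continuous)
  have "openin weak_topology {\<nu> \<in> space (prob_algebra borel). \<forall>k<n. \<bar>integral\<^sup>L \<nu> (step_test k) - z k\<bar> < d}"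
    for n :: nat and z d
  proof (induction n)
    case 0
    then show ?case using openin_topspace[of weak_topology] by (simp add: topspace_weak_topology)
  next
    case (Suc n)
    have "{\<nu> \<in> space (prob_algebra borel). \<forall>k<Suc n. \<bar>integral\<^sup>L \<nu> (step_test k) - z k\<bar> < d} =
      {\<nu> \<in> space (prob_algebra borel). \<forall>k<n. \<bar>integral\<^sup>L \<nu> (step_test k) - z k\<bar> < d} \<inter>
      {\<nu> \<in> space (prob_algebra borel). \<bar>integral\<^sup>L \<nu> (step_test n) - z n\<bar> < d}"
      by (auto simp: less_Suc_eq)
    then show ?case using openin_Int[OF Suc basic] by simp
  qed
  then show ?thesis unfolding weak_ball_def .
qed

lemma weak_ball_center: "\<mu> \<in> space (prob_algebra borel) \<Longrightarrow> \<mu> \<in> weak_ball K \<mu>"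
  by (simp add: weak_ball_def)

lemma weak_conv_mI_weak_ball:
  assumes "real_distribution \<mu>" and \<nu>: "\<And>K. \<nu> K \<in> weak_ball K \<mu>"
  shows "weak_conv_m \<nu> \<mu>"
proof (rule weak_conv_mI_step_test)
  show "real_distribution (\<nu> n)" for n
    using \<nu>[of n] by (simp add: weak_ball_def space_prob_algebra_borel_iff)
  fix k
  show "(\<lambda>n. integral\<^sup>L (\<nu> n) (step_test k)) \<longlonglongrightarrow> integral\<^sup>L \<mu> (step_test k)"
  proof (rule LIM_zero_cancel, rule tendsto_0_le[of "\<lambda>n. 1 / real (n + 1)" _ _ 1])
    show "(\<lambda>n. 1 / real (n + 1)) \<longlonglongrightarrow> 0" using LIMSEQ_Suc[OF lim_1_over_n] by simp
    show "\<forall>\<^sub>F n in sequentially. norm (integral\<^sup>L (\<nu> n) (step_test k) - integral\<^sup>L \<mu> (step_test k))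
        \<le> norm (1 / real (n + 1)) * 1"
      using eventually_gt_at_top[of k]
    proof eventually_elim
      case (elim n)
      then have "\<bar>integral\<^sup>L (\<nu> n) (step_test k) - integral\<^sup>L \<mu> (step_test k)\<bar> < 1 / real (n + 1)"
        using \<nu>[of n] unfolding weak_ball_def by blast
      then show ?case by (simp add: less_imp_le)
    qed
  qed
qed (rule assms(1))

context orlicz_risk_measure
begin

text \<open>Finitely many conditions suffice: if each \<open>K\<close> had a counterexample, these
  laws would converge weakly with controlled tails, against \<open>R_tendsto\<close>. The thresholds
  \<open>a k\<close> are fixed in advance, which lets one \<open>K\<close> serve for all the laws
  considered later. The levels \<open>(1/2) ^ k\<close> are chosen to be summable, as the union
  bound for samples requires.\<close>

lemma R_near:
  assumes \<mu>: "\<mu> \<in> orlicz_heart_laws P \<Psi>" and e: "e > 0"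
  shows "\<exists>K. \<forall>\<nu>\<in>orlicz_heart_laws P \<Psi>. \<nu> \<in> weak_ball K \<mu> \<longrightarrow>
     (\<forall>k<K. tail_integral \<Psi> k (a k) \<nu> \<le> ennreal ((1/2) ^ k)) \<longrightarrow> \<bar>R \<nu> - R \<mu>\<bar> < e"
proof (rule ccontr)
  assume "\<not> ?thesis"
  then obtain \<nu> where \<nu>: "\<And>K. \<nu> K \<in> orlicz_heart_laws P \<Psi>" "\<And>K. \<nu> K \<in> weak_ball K \<mu>"
     "\<And>K k. k < K \<Longrightarrow> tail_integral \<Psi> k (a k) (\<nu> K) \<le> ennreal ((1/2) ^ k)"
     "\<And>K. \<not> \<bar>R (\<nu> K) - R \<mu>\<bar> < e"
    by metis
  have rd: "real_distribution \<mu>" using \<mu> by (simp add: orlicz_heart_laws_iff)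
  have "(\<lambda>j. R (\<nu> j)) \<longlonglongrightarrow> R \<mu>"
  proof (rule R_tendsto[OF \<nu>(1) \<mu> weak_conv_mI_weak_ball[OF rd \<nu>(2)]])
    fix k :: nat and d :: real assume "d > 0"
    then obtain n where n: "(1/2) ^ n < d" using real_arch_pow_inv[of d "1/2"] by auto
    \<comment> \<open>Scale \<open>k\<close> is controlled only to accuracy
      \<open>(1/2) ^ k\<close>. For better accuracy its tail is dominated by the one at a larger
      scale \<open>m\<close>, whose level is below \<open>d\<close>.\<close>
    define m where "m = max k n"
    have "(1/2::real) ^ m \<le> (1/2) ^ n" by (rule power_decreasing) (simp_all add: m_def)
    from order.trans[OF this less_imp_le[OF n]] have m: "(1/2) ^ m \<le> d" .
    show "\<exists>a. \<forall>\<^sub>F j in sequentially. tail_integral \<Psi> k a (\<nu> j) \<le> ennreal d"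
    proof (rule exI[of _ "a m"], use eventually_gt_at_top[of m] in eventually_elim)
      case (elim j)
      have "tail_integral \<Psi> k (a m) (\<nu> j) \<le> tail_integral \<Psi> m (a m) (\<nu> j)"
        by (rule tail_integral_mono) (simp add: m_def)
      also have "\<dots> \<le> ennreal ((1/2) ^ m)" by (rule \<nu>(3)[OF elim])
      also have "\<dots> \<le> ennreal d" using m by (rule ennreal_leI)
      finally show ?case .
    qed
  qed
  from tendstoD[OF this e] have "\<forall>\<^sub>F j in sequentially. \<bar>R (\<nu> j) - R \<mu>\<bar> < e" by (simp add: dist_real_def)
  then show False using \<nu>(4) by simp
qed

end

text \<open>Isolates what continuity and robustness use about the aggregate laws: they come from the
  heart and have uniformly small tails at each scale.\<close>

locale uniform_tails = orlicz_risk_measure +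
  fixes M :: "real measure set"
  assumes M_laws: "M \<subseteq> orlicz_heart_laws P \<Psi>"
    and M_tails: "\<And>k e. e > 0 \<Longrightarrow> \<exists>a. \<forall>\<nu>\<in>M. tail_integral \<Psi> k a \<nu> \<le> ennreal e"
begin

lemma M_real_distribution: "\<nu> \<in> M \<Longrightarrow> real_distribution \<nu>"
  using M_laws orlicz_heart_laws_iff by blast

lemma continuous_map_R: "continuous_map (subtopology weak_topology M) euclideanreal R"
  unfolding continuous_map_def
proof (intro conjI allI impI)
  fix V :: "real set" assume V: "openin euclideanreal V"
  let ?S = "{\<mu> \<in> topspace (subtopology weak_topology M). R \<mu> \<in> V}"
  show "openin (subtopology weak_topology M) ?S"
  proof (subst openin_subopen, intro ballI)
    fix \<mu> assume \<mu>: "\<mu> \<in> ?S"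
    obtain e where e: "e > 0" "\<And>y. \<bar>y - R \<mu>\<bar> < e \<Longrightarrow> y \<in> V"
      using V \<mu> by (auto simp: open_dist dist_real_def)
    have \<mu>M: "\<mu> \<in> M" using \<mu> by simp
    have "\<exists>a. \<forall>\<nu>\<in>M. tail_integral \<Psi> k a \<nu> \<le> ennreal ((1/2) ^ k)" for k by (rule M_tails) simp
    then obtain a where a: "\<And>k \<nu>. \<nu> \<in> M \<Longrightarrow> tail_integral \<Psi> k (a k) \<nu> \<le> ennreal ((1/2) ^ k)" by metis
    obtain K where K: "\<forall>\<nu>\<in>orlicz_heart_laws P \<Psi>. \<nu> \<in> weak_ball K \<mu> \<longrightarrow>
       (\<forall>k<K. tail_integral \<Psi> k (a k) \<nu> \<le> ennreal ((1/2) ^ k)) \<longrightarrow> \<bar>R \<nu> - R \<mu>\<bar> < e"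
      using R_near[OF subsetD[OF M_laws \<mu>M] e(1)] by blast
    have "openin (subtopology weak_topology M) (M \<inter> weak_ball K \<mu>)"
      by (rule openin_subtopology_Int2[OF openin_weak_ball])
    moreover have "\<mu> \<in> M \<inter> weak_ball K \<mu>"
      using \<mu>M M_real_distribution by (simp add: weak_ball_center space_prob_algebra_borel_iff)
    moreover have "M \<inter> weak_ball K \<mu> \<subseteq> ?S"
    proof
      fix \<nu> assume \<nu>: "\<nu> \<in> M \<inter> weak_ball K \<mu>"
      then have "R \<nu> \<in> V" using K a M_laws e(2) by blast
      then show "\<nu> \<in> ?S" using \<nu> M_real_distribution
        by (simp add: topspace_weak_topology space_prob_algebra_borel_iff)
    qed
    ultimately show "\<exists>T. openin (subtopology weak_topology M) T \<and> \<mu> \<in> T \<and> T \<subseteq> ?S" by blast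
  qed
qed simp

end

section \<open>Tails of aggregates with fixed marginals\<close>

context young_function
begin

lemma nn_integral_finite_if_tail_finite:
  assumes "real_distribution \<mu>" and tail: "tail_integral \<Psi> k a \<mu> < \<infinity>"
  shows "(\<integral>\<^sup>+x. ennreal (\<Psi> \<bar>real k * x\<bar>) \<partial>\<mu>) < \<infinity>"
proof -
  interpret real_distribution \<mu> by fact
  have "(\<integral>\<^sup>+x. ennreal (\<Psi> \<bar>real k * x\<bar>) \<partial>\<mu>)
     \<le> (\<integral>\<^sup>+x. ennreal (\<Psi> \<bar>real k * a\<bar>) + ennreal (\<Psi> \<bar>real k * x\<bar>) * indicator {x. a < \<bar>x\<bar>} x \<partial>\<mu>)"
  proof (rule nn_integral_mono)
    fix x
    show "ennreal (\<Psi> \<bar>real k * x\<bar>)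
       \<le> ennreal (\<Psi> \<bar>real k * a\<bar>) + ennreal (\<Psi> \<bar>real k * x\<bar>) * indicator {x. a < \<bar>x\<bar>} x"
    proof (cases "a < \<bar>x\<bar>")
      case False
      then have "\<bar>real k * x\<bar> \<le> \<bar>real k * a\<bar>" by (simp add: abs_mult mult_left_mono)
      then show ?thesis by (intro add_increasing2 ennreal_leI mono_abs) auto
    qed simp
  qed
  also have "\<dots> = ennreal (\<Psi> \<bar>real k * a\<bar>) + tail_integral \<Psi> k a \<mu>"
    unfolding tail_integral_def by (subst nn_integral_add) (use emeasure_space_1 in simp_all)
  finally show ?thesis using tail by (auto intro: le_less_trans)
qed

text \<open>Beyond \<open>a\<close> the integrand is dominated by a sum of functions of single
  coordinates, whose integrals see only the marginals. The bound is therefore the same for every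
  dependence structure.\<close>

lemma aggregate_tails:
  fixes A :: "real ^ 'd \<Rightarrow> real" and \<mu> :: "'d \<Rightarrow> real measure"
  assumes A[measurable]: "A \<in> borel_measurable borel" and bc: "b > 0" "c > 0"
    and growth: "\<And>x. \<bar>A x\<bar> \<le> b + c * (\<Sum>i\<in>UNIV. \<bar>x $ i\<bar>)"
    and \<mu>: "\<And>i. real_distribution (\<mu> i)" "\<And>i k. (\<integral>\<^sup>+x. ennreal (\<Psi> \<bar>real k * x\<bar>) \<partial>\<mu> i) < \<infinity>"
    and e: "e > 0"
  shows "\<exists>a. \<forall>\<nu>\<in>aggregate_laws \<mu> A. tail_integral \<Psi> k a \<nu> \<le> ennreal e"
proof -
  define d where "d = real CARD('d)"
  have d: "d > 0" by (simp add: d_def)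
  \<comment> \<open>The value \<open>\<bar>A x\<bar>\<close> is divided into \<open>d + 1\<close>
    shares, one for \<open>b\<close> and one for each coordinate. If every coordinate stayed within
    its share and \<open>b\<close> strictly within its own, the growth bound would give
    \<open>\<bar>A x\<bar> < \<bar>A x\<bar>\<close>.\<close>
  obtain L :: nat where L: "(d + 1) * c \<le> real L" using real_arch_simple by blast
  have L0: "real L > 0" using L d bc by (smt (verit) mult_pos_pos)
  \<comment> \<open>The scale \<open>k * L\<close> absorbs the factor \<open>L\<close> from the
    growth bound; \<open>e / d\<close> leaves room for summing over the coordinates.\<close>
  have "\<exists>s. tail_integral \<Psi> (k * L) s (\<mu> i) \<le> ennreal (e / d)" for i
    using e d by (intro tail_integral_small[OF real_distribution.events_eq_borel[OF \<mu>(1)] \<mu>(2)]) simp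
  then obtain s where s: "\<And>i. tail_integral \<Psi> (k * L) (s i) (\<mu> i) \<le> ennreal (e / d)" by metis
  define m where "m = Max (range s)"
  have m: "s i \<le> m" for i by (simp add: m_def)
  \<comment> \<open>The first entry forces the dominating coordinate beyond \<open>m\<close>, the
    second keeps \<open>b\<close> strictly below one share of
    \<open>\<bar>A x\<bar>\<close>.\<close>
  define a where "a = max (real L * m) ((d + 1) * b)"
  have large: "\<exists>i. \<bar>A x\<bar> \<le> real L * \<bar>x $ i\<bar> \<and> m < \<bar>x $ i\<bar>" if x: "a < \<bar>A x\<bar>" for x
  proof -
    have "\<exists>i. \<bar>A x\<bar> \<le> real L * \<bar>x $ i\<bar>"
    proof (rule ccontr)
      assume "\<not> ?thesis"
      then have lt: "real L * \<bar>x $ i\<bar> < \<bar>A x\<bar>" for i by (simp add: not_le)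
      have "(d + 1) * (c * \<bar>x $ i\<bar>) \<le> \<bar>A x\<bar>" for i
        using lt[of i] mult_right_mono[OF L abs_ge_zero[of "x $ i"]] by (simp add: mult.assoc)
      then have "(\<Sum>i\<in>UNIV. (d + 1) * (c * \<bar>x $ i\<bar>)) \<le> (\<Sum>i\<in>(UNIV::'d set). \<bar>A x\<bar>)"
        by (intro sum_mono)
      then have "(d + 1) * (c * (\<Sum>i\<in>UNIV. \<bar>x $ i\<bar>)) \<le> d * \<bar>A x\<bar>"
        by (simp add: sum_distrib_left d_def)
      moreover have "(d + 1) * b < \<bar>A x\<bar>" using x by (simp add: a_def)
      moreover have "(d + 1) * \<bar>A x\<bar> \<le> (d + 1) * b + (d + 1) * (c * (\<Sum>i\<in>UNIV. \<bar>x $ i\<bar>))"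
        using mult_left_mono[OF growth[of x], of "d + 1"] d by (simp add: distrib_left)
      ultimately show False by (simp add: distrib_right)
    qed
    then obtain i where i: "\<bar>A x\<bar> \<le> real L * \<bar>x $ i\<bar>" by blast
    then have "real L * m < real L * \<bar>x $ i\<bar>" using x by (simp add: a_def)
    then show ?thesis using i L0 by auto
  qed
  have "tail_integral \<Psi> k a \<nu> \<le> ennreal e" if \<nu>: "\<nu> \<in> aggregate_laws \<mu> A" for \<nu>
  proof -
    obtain \<kappa> where \<kappa>: "\<nu> = distr \<kappa> borel A" "\<kappa> \<in> space (prob_algebra borel)"
      "\<And>i. distr \<kappa> borel (\<lambda>x. x $ i) = \<mu> i"
      using \<nu> by (auto simp: aggregate_laws_def frechet_class_def)
    have [measurable_cong]: "sets \<kappa> = sets borel" using \<kappa>(2) by (simp add: space_prob_algebra)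
    have proj[measurable]: "(\<lambda>x. x $ i) \<in> borel_measurable \<kappa>" for i :: 'd by measurable
    have "tail_integral \<Psi> k a \<nu> = (\<integral>\<^sup>+x. ennreal (\<Psi> \<bar>real k * A x\<bar>) * indicator {x. a < \<bar>x\<bar>} (A x) \<partial>\<kappa>)"
      unfolding \<kappa>(1) tail_integral_def by (rule nn_integral_distr) measurable
    also have "\<dots> \<le> (\<integral>\<^sup>+x. (\<Sum>i\<in>UNIV. ennreal (\<Psi> \<bar>real (k * L) * (x $ i)\<bar>) * indicator {x. m < \<bar>x\<bar>} (x $ i)) \<partial>\<kappa>)"
    proof (rule nn_integral_mono)
      fix x :: "real ^ 'd"
      let ?g = "\<lambda>i. ennreal (\<Psi> \<bar>real (k * L) * (x $ i)\<bar>) * indicator {x. m < \<bar>x\<bar>} (x $ i)"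
      show "ennreal (\<Psi> \<bar>real k * A x\<bar>) * indicator {x. a < \<bar>x\<bar>} (A x) \<le> (\<Sum>i\<in>UNIV. ?g i)"
      proof (cases "a < \<bar>A x\<bar>")
        case True
        then obtain i where i: "\<bar>A x\<bar> \<le> real L * \<bar>x $ i\<bar>" "m < \<bar>x $ i\<bar>" using large by blast
        from mult_left_mono[OF i(1), of "real k"]
        have "\<bar>real k * A x\<bar> \<le> \<bar>real (k * L) * (x $ i)\<bar>" by (simp add: abs_mult mult.assoc)
        then have "ennreal (\<Psi> \<bar>real k * A x\<bar>) * indicator {x. a < \<bar>x\<bar>} (A x) \<le> ?g i"
          using True i(2) by (simp only: mem_Collect_eq indicator_simps mult_1_right ennreal_leI mono_abs)
        also have "\<dots> \<le> (\<Sum>i\<in>UNIV. ?g i)" by (rule member_le_sum) auto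
        finally show ?thesis .
      qed simp
    qed
    also have "\<dots> = (\<Sum>i\<in>UNIV. \<integral>\<^sup>+x. ennreal (\<Psi> \<bar>real (k * L) * (x $ i)\<bar>) * indicator {x. m < \<bar>x\<bar>} (x $ i) \<partial>\<kappa>)"
      by (rule nn_integral_sum) measurable
    also have "\<dots> = (\<Sum>i\<in>UNIV. tail_integral \<Psi> (k * L) m (\<mu> i))"
      unfolding \<kappa>(3)[symmetric] tail_integral_def
      by (intro sum.cong refl nn_integral_distr[symmetric]) measurable
    also have "\<dots> \<le> (\<Sum>i\<in>(UNIV::'d set). ennreal (e / d))"
      using order.trans[OF tail_integral_antimono[OF m] s] by (rule sum_mono)
    also have "\<dots> = ennreal e"
      using e d by (simp add: d_def ennreal_of_nat_eq_real_of_nat flip: ennreal_mult)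
    finally show ?thesis .
  qed
  then show ?thesis by blast
qed

end

section \<open>Robustness\<close>

lemma indep_vars_coordinates:
  assumes "prob_space N"
  shows "prob_space.indep_vars (Pi\<^sub>M UNIV (\<lambda>_::nat. N)) (\<lambda>_. N) (\<lambda>i x. x i) UNIV"
proof -
  interpret Q: product_prob_space "\<lambda>_::nat. N" UNIV
    using assms by (simp add: product_prob_space_def product_sigma_finite_def product_prob_space_axioms_def
        prob_space_imp_sigma_finite)
  have "distr (Pi\<^sub>M UNIV (\<lambda>_. N)) (Pi\<^sub>M UNIV (\<lambda>_. N)) (\<lambda>x. \<lambda>i\<in>UNIV. x i) =
     (\<Pi>\<^sub>M i\<in>UNIV. distr (Pi\<^sub>M UNIV (\<lambda>_. N)) N (\<lambda>x. x (i::nat)))"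
    using Q.PiM_component by (simp add: restrict_def distr_id)
  then show ?thesis by (subst Q.indep_vars_iff_distr_eq_PiM) simp_all
qed

text \<open>Transports a coupling from the base space to samples: applying two coupled variables in
  each coordinate couples the two product laws on one space.\<close>

lemma distr_PiM_coordinatewise:
  assumes N: "prob_space N" and Y: "Y \<in> borel_measurable N"
  shows "distr (Pi\<^sub>M UNIV (\<lambda>_::nat. N)) (Pi\<^sub>M UNIV (\<lambda>_. borel)) (\<lambda>\<omega> i. Y (\<omega> i)) =
     Pi\<^sub>M UNIV (\<lambda>_. distr N borel Y)"
proof -
  interpret Q: product_prob_space "\<lambda>_::nat. N" UNIV
    using N by (simp add: product_prob_space_def product_sigma_finite_def product_prob_space_axioms_def
        prob_space_imp_sigma_finite)
  have m: "(\<lambda>\<omega>. \<omega> i) \<in> Pi\<^sub>M UNIV (\<lambda>_::nat. N) \<rightarrow>\<^sub>M N" for i by simp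
  have "Q.indep_vars (\<lambda>_. borel) (\<lambda>i \<omega>. Y (\<omega> i)) UNIV"
    using indep_vars_coordinates[OF N] Y by (rule Q.indep_vars_compose2)
  then have "distr (Pi\<^sub>M UNIV (\<lambda>_::nat. N)) (Pi\<^sub>M UNIV (\<lambda>_. borel)) (\<lambda>\<omega>. \<lambda>i\<in>UNIV. Y (\<omega> i)) =
     (\<Pi>\<^sub>M i\<in>UNIV. distr (Pi\<^sub>M UNIV (\<lambda>_::nat. N)) borel (\<lambda>\<omega>. Y (\<omega> i)))"
    by (subst (asm) Q.indep_vars_iff_distr_eq_PiM) (use Y measurable_compose[OF m] in auto)
  moreover have "distr (Pi\<^sub>M UNIV (\<lambda>_::nat. N)) borel (\<lambda>\<omega>. Y (\<omega> i)) = distr N borel Y" for i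
  proof -
    have "distr (distr (Pi\<^sub>M UNIV (\<lambda>_::nat. N)) N (\<lambda>\<omega>. \<omega> i)) borel Y =
        distr (Pi\<^sub>M UNIV (\<lambda>_::nat. N)) borel (Y \<circ> (\<lambda>\<omega>. \<omega> i))"
      by (rule distr_distr[OF Y m])
    then show ?thesis using Q.PiM_component[of i] by (simp add: comp_def)
  qed
  ultimately show ?thesis by (simp add: restrict_def)
qed

section \<open>Upper bounds for the Prohorov distance\<close>

lemma prohorov_dist_leI:
  assumes "e > 0"
    and "\<And>B. B \<in> sets borel \<Longrightarrow> measure \<mu> B \<le> measure \<nu> {x. \<exists>a\<in>B. dist x a < e} + e"
    and "\<And>B. B \<in> sets borel \<Longrightarrow> measure \<nu> B \<le> measure \<mu> {x. \<exists>a\<in>B. dist x a < e} + e"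
  shows "prohorov_dist \<mu> \<nu> \<le> e"
  unfolding prohorov_dist_def
  by (rule cInf_lower) (use assms in \<open>auto intro!: bdd_belowI[of _ 0]\<close>)

lemma open_enlargement: "open {x::'a::metric_space. \<exists>a\<in>B. dist x a < e}"
proof -
  have "{x. \<exists>a\<in>B. dist x a < e} = (\<Union>a\<in>B. ball a e)" by (auto simp: dist_commute)
  then show ?thesis by auto
qed

text \<open>The easy half of Strassen's theorem: if \<open>S\<close> is in \<open>B\<close>, then
  either \<open>T\<close> is in the open enlargement of \<open>B\<close> or the two variables are at
  least \<open>e\<close> apart.\<close>

lemma (in prob_space) prohorov_dist_coupling:
  fixes S T :: "'a \<Rightarrow> real"
  assumes [measurable]: "S \<in> borel_measurable M" "T \<in> borel_measurable M"
    and e: "e > 0" and close: "prob {\<omega>\<in>space M. e \<le> dist (S \<omega>) (T \<omega>)} \<le> e"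
  shows "prohorov_dist (distr M borel S) (distr M borel T) \<le> e"
proof -
  have main: "measure (distr M borel S) B \<le> measure (distr M borel T) {x. \<exists>a\<in>B. dist x a < e} + e"
    if [measurable]: "S \<in> borel_measurable M" "T \<in> borel_measurable M" and B[measurable]: "B \<in> sets borel"
      and close: "prob {\<omega>\<in>space M. e \<le> dist (S \<omega>) (T \<omega>)} \<le> e"
    for B and S T :: "'a \<Rightarrow> real"
  proof -
    let ?B = "{x. \<exists>a\<in>B. dist x a < e}"
    have B'[measurable]: "?B \<in> sets borel" using open_enlargement by (rule borel_open)
    let ?far = "{\<omega>\<in>space M. e \<le> dist (S \<omega>) (T \<omega>)}"
    have T: "T -` ?B \<inter> space M \<in> sets M" by (rule measurable_sets[OF that(2) B'])
    have "prob (S -` B \<inter> space M) \<le> prob ((T -` ?B \<inter> space M) \<union> ?far)"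
    proof (rule finite_measure_mono)
      show "S -` B \<inter> space M \<subseteq> (T -` ?B \<inter> space M) \<union> ?far"
      proof
        fix \<omega> assume \<omega>: "\<omega> \<in> S -` B \<inter> space M"
        show "\<omega> \<in> (T -` ?B \<inter> space M) \<union> ?far"
        proof (cases "e \<le> dist (S \<omega>) (T \<omega>)")
          case False
          then have "dist (T \<omega>) (S \<omega>) < e" by (simp add: dist_commute)
          then have "T \<omega> \<in> ?B" using \<omega> by blast
          then show ?thesis using \<omega> by simp
        qed (use \<omega> in simp)
      qed
    qed (intro sets.Un T, measurable)
    also have "\<dots> \<le> prob (T -` ?B \<inter> space M) + prob ?far"
      by (intro measure_Un_le T) measurable
    finally show ?thesis using close by (simp only: measure_distr[OF that(1) B] measure_distr[OF that(2) B'])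
  qed
  show ?thesis
    using e main[of S T] main[of T S] close by (intro prohorov_dist_leI) (simp_all add: dist_commute)
qed

text \<open>Serves large samples, where both estimators gather around the same value
  \<open>z\<close>. A set meeting the \<open>e\<close>-ball about \<open>z\<close> has a
  \<open>2 * e\<close>-enlargement containing that ball; any other set lies where
  \<open>\<mu>\<close> has little mass.\<close>

lemma prohorov_dist_concentrated:
  fixes \<mu> \<nu> :: "real measure"
  assumes \<mu>: "real_distribution \<mu>" and \<nu>: "real_distribution \<nu>" and e: "e > 0"
    and c: "measure \<mu> {x. e \<le> \<bar>x - z\<bar>} \<le> e" "measure \<nu> {x. e \<le> \<bar>x - z\<bar>} \<le> e"
  shows "prohorov_dist \<mu> \<nu> \<le> 2 * e"
proof -
  have main: "measure \<mu> B \<le> measure \<nu> {x. \<exists>a\<in>B. dist x a < 2 * e} + 2 * e"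
    if \<mu>: "real_distribution \<mu>" and \<nu>: "real_distribution \<nu>" and B: "B \<in> sets borel"
      and c: "measure \<mu> {x. e \<le> \<bar>x - z\<bar>} \<le> e" "measure \<nu> {x. e \<le> \<bar>x - z\<bar>} \<le> e"
    for \<mu> \<nu> :: "real measure" and B
  proof -
    interpret \<mu>: real_distribution \<mu> by fact
    interpret \<nu>: real_distribution \<nu> by fact
    show ?thesis
    proof (cases "\<exists>b\<in>B. \<bar>b - z\<bar> < e")
      case True
      then obtain b where b: "b \<in> B" "\<bar>b - z\<bar> < e" by blast
      have "1 - measure \<nu> {x. e \<le> \<bar>x - z\<bar>} = measure \<nu> (space \<nu> - {x. e \<le> \<bar>x - z\<bar>})"
        by (rule \<nu>.prob_compl[symmetric]) simp
      also have "\<dots> \<le> measure \<nu> {x. \<exists>a\<in>B. dist x a < 2 * e}"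
      proof (rule \<nu>.finite_measure_mono)
        show "space \<nu> - {x. e \<le> \<bar>x - z\<bar>} \<subseteq> {x. \<exists>a\<in>B. dist x a < 2 * e}"
        proof
          fix x assume "x \<in> space \<nu> - {x. e \<le> \<bar>x - z\<bar>}"
          then have "dist x b < 2 * e" using b by (auto simp: dist_real_def)
          then show "x \<in> {x. \<exists>a\<in>B. dist x a < 2 * e}" using b by blast
        qed
      qed (use borel_open[OF open_enlargement] in simp)
      finally show ?thesis using c(2) \<mu>.prob_le_1[of B] e by linarith
    next
      case False
      then have "measure \<mu> B \<le> measure \<mu> {x. e \<le> \<bar>x - z\<bar>}"
        by (intro \<mu>.finite_measure_mono) (auto simp: not_less)
      then show ?thesis using c(1) e measure_nonneg[of \<nu> "{x. \<exists>a\<in>B. dist x a < 2 * e}"] by linarith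
    qed
  qed
  show ?thesis
    using e main[OF \<mu> \<nu> _ c] main[OF \<nu> \<mu> _ c(2) c(1)] by (intro prohorov_dist_leI) simp_all
qed

section \<open>Empirical measures and their deviations\<close>

lemma measurable_empirical [measurable]: "x \<in> borel_measurable (uniform_count_measure {..<n})"
  by (simp add: measurable_def sets_uniform_count_measure space_uniform_count_measure)

lemma real_distribution_empirical: "n \<ge> 1 \<Longrightarrow> real_distribution (empirical_measure n x)"
  unfolding empirical_measure_def
  by (intro prob_space.real_distribution_distr prob_space_uniform_count_measure) (auto simp: lessThan_empty_iff)

lemma nn_integral_empirical:
  assumes "g \<in> borel_measurable borel"
  shows "(\<integral>\<^sup>+y. g y \<partial>empirical_measure n x) = (\<Sum>i<n. ennreal (1 / n) * g (x i))"
  unfolding empirical_measure_def using assms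
  by (simp add: nn_integral_distr uniform_count_measure_def nn_integral_point_measure_finite
      measurable_empirical[unfolded uniform_count_measure_def])

lemma integral_empirical:
  fixes g :: "real \<Rightarrow> real"
  assumes "g \<in> borel_measurable borel"
  shows "integral\<^sup>L (empirical_measure n x) g = (\<Sum>i<n. g (x i)) / n"
  unfolding empirical_measure_def using assms
  by (simp add: integral_distr integral_uniform_count_measure)

text \<open>All step tests take values in the unit interval, so Hoeffding's bound depends on neither
  \<open>\<nu>\<close> nor \<open>k\<close>. This gives a sample size valid for a whole
  neighbourhood.\<close>

lemma empirical_step_test_deviation:
  assumes \<nu>: "real_distribution \<nu>" and n: "n \<ge> 1" and d: "d > 0"
  shows "measure (Pi\<^sub>M UNIV (\<lambda>_. \<nu>)) {x\<in>space (Pi\<^sub>M UNIV (\<lambda>_. \<nu>)).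
      d \<le> \<bar>integral\<^sup>L (empirical_measure n x) (step_test k) - integral\<^sup>L \<nu> (step_test k)\<bar>}
    \<le> 2 * exp (-2 * real n * d\<^sup>2)"
proof -
  interpret \<nu>: real_distribution \<nu> by fact
  let ?Q = "Pi\<^sub>M UNIV (\<lambda>_::nat. \<nu>)"
  interpret Q: product_prob_space "\<lambda>_::nat. \<nu>" UNIV ..
  have m: "(\<lambda>x. x i) \<in> ?Q \<rightarrow>\<^sub>M \<nu>" for i by simp
  have f: "step_test k \<in> borel_measurable \<nu>" by simp
  have comp: "distr ?Q borel (\<lambda>x. step_test k (x i)) = distr \<nu> borel (step_test k)" for i
    using distr_distr[OF f m[of i]] Q.PiM_component[of i] by (simp add: comp_def)
  interpret H: Hoeffding_ineq_iid ?Q "{..<n}" "\<lambda>i x. step_test k (x i)" "\<lambda>x. step_test k (x 0)" 0 1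
      "Q.expectation (\<lambda>x. step_test k (x 0))"
  proof unfold_locales
    have "Q.indep_vars (\<lambda>_. borel) (\<lambda>i x. step_test k (x i)) UNIV"
      using indep_vars_coordinates[OF \<nu>.prob_space_axioms] f by (rule Q.indep_vars_compose2)
    then show "Q.indep_vars (\<lambda>_. borel) (\<lambda>i x. step_test k (x i)) {..<n}"
      by (rule Q.indep_vars_subset) simp
    show "(\<lambda>x. step_test k (x 0)) \<in> borel_measurable ?Q" by (rule measurable_compose[OF m f])
  qed (simp_all add: comp step_test_bounds)
  have "Q.expectation (\<lambda>x. step_test k (x 0)) = integral\<^sup>L (distr ?Q \<nu> (\<lambda>x. x 0)) (step_test k)"
    by (rule integral_distr[OF m f, symmetric])
  then have "Q.expectation (\<lambda>x. step_test k (x 0)) = integral\<^sup>L \<nu> (step_test k)"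
    using Q.PiM_component[of 0] by simp
  moreover have "{..<n} \<noteq> {}" using n by (auto simp: lessThan_empty_iff)
  ultimately show ?thesis
    using H.Hoeffding_ineq_abs_ge'[of d] d by (simp add: integral_empirical)
qed

text \<open>The mean of the empirical tail is the tail of \<open>\<nu>\<close>, whatever the sample
  size. Markov's inequality at level \<open>(1/2) ^ k\<close> costs a factor \<open>2 ^ k\<close>,
  so a tail of order \<open>(1/4) ^ k\<close> leaves a probability summable in
  \<open>k\<close>.\<close>

lemma (in young_function) empirical_tail_deviation:
  assumes \<nu>: "real_distribution \<nu>" and n: "n \<ge> 1" and e: "e \<ge> 0"
    and tail: "tail_integral \<Psi> k a \<nu> \<le> ennreal ((1/4) ^ k * e)"
  shows "{x\<in>space (Pi\<^sub>M UNIV (\<lambda>_. \<nu>)). \<not> tail_integral \<Psi> k a (empirical_measure n x) \<le> ennreal ((1/2) ^ k)}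
       \<in> sets (Pi\<^sub>M UNIV (\<lambda>_. \<nu>))"
    and "measure (Pi\<^sub>M UNIV (\<lambda>_. \<nu>)) {x\<in>space (Pi\<^sub>M UNIV (\<lambda>_. \<nu>)).
      \<not> tail_integral \<Psi> k a (empirical_measure n x) \<le> ennreal ((1/2) ^ k)} \<le> (1/2) ^ k * e"
proof -
  interpret \<nu>: real_distribution \<nu> by fact
  let ?Q = "Pi\<^sub>M UNIV (\<lambda>_::nat. \<nu>)"
  interpret Q: product_prob_space "\<lambda>_::nat. \<nu>" UNIV ..
  define h where "h y = ennreal (\<Psi> \<bar>real k * y\<bar>) * indicator {y. a < \<bar>y\<bar>} y" for y
  have h[measurable]: "h \<in> borel_measurable borel" unfolding h_def by measurable
  have h': "h \<in> borel_measurable \<nu>" by simp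
  have m: "(\<lambda>x. x i) \<in> ?Q \<rightarrow>\<^sub>M \<nu>" for i by simp
  have hi[measurable]: "(\<lambda>x. h (x i)) \<in> borel_measurable ?Q" for i by (rule measurable_compose[OF m h'])
  define u where "u x = (\<Sum>i<n. ennreal (1 / n) * h (x i))" for x :: "nat \<Rightarrow> real"
  have [measurable]: "u \<in> borel_measurable ?Q" unfolding u_def by measurable
  have u: "tail_integral \<Psi> k a (empirical_measure n x) = u x" for x
    unfolding tail_integral_def u_def h_def[symmetric] by (rule nn_integral_empirical[OF h])
  show S: "{x\<in>space ?Q. \<not> tail_integral \<Psi> k a (empirical_measure n x) \<le> ennreal ((1/2) ^ k)} \<in> sets ?Q"
    unfolding u by measurable
  have int_h: "(\<integral>\<^sup>+x. h (x i) \<partial>?Q) = tail_integral \<Psi> k a \<nu>" for i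
  proof -
    have "(\<integral>\<^sup>+x. h (x i) \<partial>?Q) = (\<integral>\<^sup>+y. h y \<partial>distr ?Q \<nu> (\<lambda>x. x i))"
      by (rule nn_integral_distr[OF m, symmetric]) (simp add: h')
    then show ?thesis using Q.PiM_component[of i] by (simp add: tail_integral_def h_def)
  qed
  have "(\<integral>\<^sup>+x. u x \<partial>?Q) = (\<Sum>i<n. ennreal (1 / n) * tail_integral \<Psi> k a \<nu>)"
    unfolding u_def by (subst nn_integral_sum, measurable) (simp add: nn_integral_cmult int_h)
  also have "\<dots> = tail_integral \<Psi> k a \<nu>"
    using n by (simp add: ennreal_of_nat_eq_real_of_nat mult.assoc[symmetric] flip: ennreal_mult)
  finally have int_u: "(\<integral>\<^sup>+x. u x \<partial>?Q) = tail_integral \<Psi> k a \<nu>" .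
  have "emeasure ?Q {x\<in>space ?Q. \<not> tail_integral \<Psi> k a (empirical_measure n x) \<le> ennreal ((1/2) ^ k)}
     \<le> emeasure ?Q ({x\<in>space ?Q. 1 \<le> ennreal (2 ^ k) * u x})"
  proof (rule emeasure_mono)
    show "{x\<in>space ?Q. \<not> tail_integral \<Psi> k a (empirical_measure n x) \<le> ennreal ((1/2) ^ k)}
       \<subseteq> {x\<in>space ?Q. 1 \<le> ennreal (2 ^ k) * u x}"
    proof (safe, simp only: u not_le)
      fix x assume "ennreal ((1/2) ^ k) < u x"
      then have "ennreal (2 ^ k) * ennreal ((1/2) ^ k) \<le> ennreal (2 ^ k) * u x"
        by (intro mult_left_mono) auto
      moreover have "ennreal (2 ^ k) * ennreal ((1/2) ^ k) = 1"
        by (subst ennreal_mult[symmetric]) (simp_all flip: power_mult_distrib)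
      ultimately show "1 \<le> ennreal (2 ^ k) * u x" by simp
    qed
  qed measurable
  also have "\<dots> \<le> ennreal (2 ^ k) * (\<integral>\<^sup>+x. u x \<partial>?Q)"
  proof -
    have "emeasure ?Q {x\<in>space ?Q. 1 \<le> ennreal (2 ^ k) * u x}
       \<le> ennreal (2 ^ k) * (\<integral>\<^sup>+x. u x * indicator (space ?Q) x \<partial>?Q)"
      by (rule nn_integral_Markov_inequality) measurable
    also have "(\<integral>\<^sup>+x. u x * indicator (space ?Q) x \<partial>?Q) = (\<integral>\<^sup>+x. u x \<partial>?Q)"
      by (rule nn_integral_cong) simp
    finally show ?thesis .
  qed
  also have "\<dots> \<le> ennreal (2 ^ k) * ennreal ((1/4) ^ k * e)"
    unfolding int_u using tail by (rule mult_left_mono) simp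
  also have "\<dots> = ennreal ((1/2) ^ k * e)"
    using e by (subst ennreal_mult[symmetric]) (simp_all add: mult.assoc[symmetric] flip: power_mult_distrib)
  finally show "measure ?Q {x\<in>space ?Q. \<not> tail_integral \<Psi> k a (empirical_measure n x) \<le> ennreal ((1/2) ^ k)}
     \<le> (1/2) ^ k * e"
    unfolding Q.emeasure_eq_measure by (subst (asm) ennreal_le_iff) (use e in simp_all)
qed

lemma weak_ball_antimono: "K \<le> L \<Longrightarrow> weak_ball L \<mu> \<subseteq> weak_ball K \<mu>"
proof
  fix \<nu> assume "K \<le> L" and \<nu>: "\<nu> \<in> weak_ball L \<mu>"
  have "1 / real (L + 1) \<le> 1 / real (K + 1)" using \<open>K \<le> L\<close> by (simp add: frac_le)
  then show "\<nu> \<in> weak_ball K \<mu>"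
    using \<nu> \<open>K \<le> L\<close> unfolding weak_ball_def by (auto intro: less_le_trans)
qed

section \<open>The plug-in estimator at a fixed sample size\<close>

context orlicz_risk_measure
begin

lemma empirical_in_laws:
  assumes n: "n \<ge> 1"
  shows "empirical_measure n x \<in> orlicz_heart_laws P \<Psi>"
  unfolding orlicz_heart_laws_iff
  by (intro conjI allI real_distribution_empirical[OF n])
     (subst nn_integral_empirical, simp_all add: ennreal_mult_less_top)

text \<open>Finitely many convergent coordinates are eventually bounded, so beyond a suitable
  threshold the empirical tails are not merely small but zero.\<close>

lemma plug_in_tendsto:
  assumes n: "n \<ge> 1" and lim: "\<And>i. (\<lambda>j. x j i) \<longlonglongrightarrow> y i"
  shows "(\<lambda>j. R (empirical_measure n (x j))) \<longlonglongrightarrow> R (empirical_measure n y)"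
proof (rule R_tendsto[OF empirical_in_laws[OF n] empirical_in_laws[OF n]])
  show "weak_conv_m (\<lambda>j. empirical_measure n (x j)) (empirical_measure n y)"
  proof (rule weak_conv_mI_step_test[OF real_distribution_empirical[OF n] real_distribution_empirical[OF n]])
    fix k
    have "(\<lambda>j. (\<Sum>i<n. step_test k (x j i)) / real n) \<longlonglongrightarrow> (\<Sum>i<n. step_test k (y i)) / real n"
      by (intro tendsto_divide tendsto_sum tendsto_const
          continuous_on_tendsto_compose[OF step_test_continuous lim]) (use n in auto)
    then show "(\<lambda>j. integral\<^sup>L (empirical_measure n (x j)) (step_test k)) \<longlonglongrightarrow>
        integral\<^sup>L (empirical_measure n y) (step_test k)"
      by (simp add: integral_empirical)
  qed
next
  fix k :: nat and e :: real assume "e > 0"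
  define a where "a = (\<Sum>i<n. \<bar>y i\<bar>) + 1"
  have "\<forall>\<^sub>F j in sequentially. \<bar>x j i\<bar> < a" if i: "i < n" for i
  proof (rule order_tendstoD(2)[OF tendsto_rabs[OF lim]])
    have "\<bar>y i\<bar> \<le> (\<Sum>i<n. \<bar>y i\<bar>)" using i by (intro member_le_sum) auto
    then show "\<bar>y i\<bar> < a" by (simp add: a_def)
  qed
  then have "\<forall>\<^sub>F j in sequentially. \<forall>i\<in>{..<n}. \<bar>x j i\<bar> < a"
    by (intro eventually_ball_finite) auto
  then have "\<forall>\<^sub>F j in sequentially. tail_integral \<Psi> k a (empirical_measure n (x j)) \<le> ennreal e"
  proof eventually_elim
    case (elim j)
    have "tail_integral \<Psi> k a (empirical_measure n (x j)) =
       (\<Sum>i<n. ennreal (1 / n) * (ennreal (\<Psi> \<bar>real k * x j i\<bar>) * indicator {z. a < \<bar>z\<bar>} (x j i)))"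
      unfolding tail_integral_def by (rule nn_integral_empirical) measurable
    also have "\<dots> = 0" using elim by (intro sum.neutral) (auto simp: not_less less_imp_le)
    finally show ?case by simp
  qed
  then show "\<exists>a. \<forall>\<^sub>F j in sequentially. tail_integral \<Psi> k a (empirical_measure n (x j)) \<le> ennreal e" by blast
qed

text \<open>Sequential continuity on the countable product is continuity, and its Borel sets are
  those of the product sigma-algebra.\<close>

lemma plug_in_measurable:
  assumes n: "n \<ge> 1"
  shows "(\<lambda>x. R (empirical_measure n x)) \<in> borel_measurable (Pi\<^sub>M UNIV (\<lambda>_::nat. borel))"
proof -
  have "continuous_on UNIV (\<lambda>x::nat \<Rightarrow> real. R (empirical_measure n x))"
  proof (rule continuous_on_sequentiallyI)
    fix u :: "nat \<Rightarrow> nat \<Rightarrow> real" and y assume "u \<longlonglongrightarrow> y"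
    then have "(\<lambda>j. u j i) \<longlonglongrightarrow> y i" for i
      using continuous_on_tendsto_compose[OF continuous_on_product_coordinates[of i]] by auto
    then show "(\<lambda>j. R (empirical_measure n (u j))) \<longlonglongrightarrow> R (empirical_measure n y)"
      by (rule plug_in_tendsto[OF n])
  qed
  then have "(\<lambda>x::nat \<Rightarrow> real. R (empirical_measure n x)) \<in> borel_measurable borel"
    by (rule borel_measurable_continuous_onI)
  then show ?thesis by (simp cong: measurable_cong_sets[OF sets_PiM_equal_borel refl])
qed

text \<open>Failure for every \<open>K\<close> would give a weakly convergent sequence of laws.
  Coupling it on \<open>P\<close> and taking independent copies makes the estimators converge almost
  surely, hence in probability, and \<open>prohorov_dist_coupling\<close> contradicts the
  failure.\<close>

lemma small_sample:
  assumes n: "n \<ge> 1" and e: "e > 0" and \<mu>: "real_distribution \<mu>"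
  shows "\<exists>K. \<forall>\<nu>\<in>weak_ball K \<mu>.
     prohorov_dist (distr (Pi\<^sub>M UNIV (\<lambda>_. \<mu>)) borel (\<lambda>x. R (empirical_measure n x)))
                   (distr (Pi\<^sub>M UNIV (\<lambda>_. \<nu>)) borel (\<lambda>x. R (empirical_measure n x))) \<le> e"
proof (rule ccontr)
  let ?T = "\<lambda>x. R (empirical_measure n x)"
  assume "\<not> ?thesis"
  then obtain \<nu> where \<nu>: "\<And>K. \<nu> K \<in> weak_ball K \<mu>"
    "\<And>K. \<not> prohorov_dist (distr (Pi\<^sub>M UNIV (\<lambda>_. \<mu>)) borel ?T) (distr (Pi\<^sub>M UNIV (\<lambda>_. \<nu> K)) borel ?T) \<le> e"
    by metis
  have rd: "real_distribution (\<nu> K)" for K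
    using \<nu>(1)[of K] by (simp add: weak_ball_def space_prob_algebra_borel_iff)
  obtain Y X where Y: "\<And>K. Y K \<in> borel_measurable P" and dY: "\<And>K. distr P borel (Y K) = \<nu> K"
    and X: "X \<in> borel_measurable P" and dX: "distr P borel X = \<mu>"
    and lim: "AE \<omega> in P. (\<lambda>K. Y K \<omega>) \<longlonglongrightarrow> X \<omega>"
    using skorohod_on_atomless[OF atomless rd \<mu> weak_conv_mI_weak_ball[OF \<mu> \<nu>(1)]] by blast
  let ?Q = "Pi\<^sub>M UNIV (\<lambda>_::nat. P)"
  interpret Q: product_prob_space "\<lambda>_::nat. P" UNIV ..
  have G: "(\<lambda>\<omega> i. Z (\<omega> i)) \<in> ?Q \<rightarrow>\<^sub>M Pi\<^sub>M UNIV (\<lambda>_. borel)"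
    if "Z \<in> borel_measurable P" for Z :: "'a \<Rightarrow> real"
    by (rule measurable_PiM_single') (use that in \<open>auto intro: measurable_compose[OF measurable_component_singleton]\<close>)
  note T = plug_in_measurable[OF n]
  have TG: "(\<lambda>\<omega>. ?T (\<lambda>i. Z (\<omega> i))) \<in> borel_measurable ?Q"
    if "Z \<in> borel_measurable P" for Z :: "'a \<Rightarrow> real"
    by (rule measurable_compose[OF G[OF that] T])
  have law: "distr (Pi\<^sub>M UNIV (\<lambda>_. distr P borel Z)) borel ?T = distr ?Q borel (\<lambda>\<omega>. ?T (\<lambda>i. Z (\<omega> i)))"
    if "Z \<in> borel_measurable P" for Z :: "'a \<Rightarrow> real"
    unfolding distr_PiM_coordinatewise[OF prob_space_axioms that, symmetric]
    by (subst distr_distr[OF T G[OF that]]) (simp add: comp_def)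
  define bad where "bad K = {\<omega>\<in>space ?Q. e \<le> dist (?T (\<lambda>i. X (\<omega> i))) (?T (\<lambda>i. Y K (\<omega> i)))}" for K
  have bad: "bad K \<in> sets ?Q" for K
    unfolding bad_def by (intro borel_measurable_le borel_measurable_const borel_measurable_dist TG X Y)
  \<comment> \<open>A countable intersection of almost sure events: all coordinates converge at
    once.\<close>
  have "AE \<omega> in ?Q. \<forall>i. (\<lambda>K. Y K (\<omega> i)) \<longlonglongrightarrow> X (\<omega> i)"
    unfolding AE_all_countable
    using Q.AE_component[OF UNIV_I, of "\<lambda>\<omega>. (\<lambda>K. Y K \<omega>) \<longlonglongrightarrow> X \<omega>", OF lim] by blast
  then have ae: "AE \<omega> in ?Q. (\<lambda>K. indicator (bad K) \<omega> :: real) \<longlonglongrightarrow> 0"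
  proof eventually_elim
    case (elim \<omega>)
    then have "(\<lambda>K. ?T (\<lambda>i. Y K (\<omega> i))) \<longlonglongrightarrow> ?T (\<lambda>i. X (\<omega> i))" by (intro plug_in_tendsto[OF n]) simp
    from tendstoD[OF this e] have "\<forall>\<^sub>F K in sequentially. (indicator (bad K) \<omega> :: real) = 0"
      by eventually_elim (simp add: bad_def dist_commute)
    then show ?case by (rule tendsto_eventually)
  qed
  have "(\<lambda>K. \<integral>\<omega>. indicator (bad K) \<omega> \<partial>?Q) \<longlonglongrightarrow> (\<integral>\<omega>. (0::real) \<partial>?Q)"
  proof (rule integral_dominated_convergence[where w="\<lambda>_. 1", OF _ _ _ ae])
    show "indicat_real (bad K) \<in> borel_measurable ?Q" for K by (rule borel_measurable_indicator[OF bad])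
    show "AE \<omega> in ?Q. norm (indicat_real (bad K) \<omega>) \<le> 1" for K
      by (rule AE_I2) (simp add: indicator_def)
  qed simp_all
  then have "(\<lambda>K. Q.prob (bad K)) \<longlonglongrightarrow> 0"
    by (simp add: bad)
  from order_tendstoD(2)[OF this e] obtain K where "Q.prob (bad K) < e"
    using eventually_happens'[OF sequentially_bot] by blast
  then have "prohorov_dist (distr ?Q borel (\<lambda>\<omega>. ?T (\<lambda>i. X (\<omega> i)))) (distr ?Q borel (\<lambda>\<omega>. ?T (\<lambda>i. Y K (\<omega> i)))) \<le> e"
    using e unfolding bad_def by (intro Q.prohorov_dist_coupling TG X Y) simp_all
  then show False using \<nu>(2)[of K] law[OF X] law[OF Y[of K]] dX dY by simp
qed

end

section \<open>Uniform control over sample sizes\<close>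

context uniform_tails
begin

lemma large_sample:
  assumes \<mu>: "\<mu> \<in> M" and e: "e > 0"
  shows "\<exists>K N. \<forall>\<nu>\<in>M \<inter> weak_ball K \<mu>. \<forall>n\<ge>N. n \<ge> 1 \<longrightarrow>
     measure (distr (Pi\<^sub>M UNIV (\<lambda>_. \<nu>)) borel (\<lambda>x. R (empirical_measure n x))) {y. e \<le> \<bar>y - R \<mu>\<bar>} \<le> e"
proof -
  \<comment> \<open>Markov's inequality turns this bound into \<open>(1/2) ^ k * (e / 4)\<close>,
    and the sum over \<open>k\<close> is at most \<open>e / 2\<close>. The other half of
    \<open>e\<close> is reserved for the Hoeffding terms.\<close>
  have "\<exists>a. \<forall>\<nu>\<in>M. tail_integral \<Psi> k a \<nu> \<le> ennreal ((1/4) ^ k * (e / 4))" for k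
    using e by (intro M_tails) simp
  then obtain a where a: "\<And>k \<nu>. \<nu> \<in> M \<Longrightarrow> tail_integral \<Psi> k (a k) \<nu> \<le> ennreal ((1/4) ^ k * (e / 4))" by metis
  obtain K where K: "\<forall>\<nu>\<in>orlicz_heart_laws P \<Psi>. \<nu> \<in> weak_ball K \<mu> \<longrightarrow>
     (\<forall>k<K. tail_integral \<Psi> k (a k) \<nu> \<le> ennreal ((1/2) ^ k)) \<longrightarrow> \<bar>R \<nu> - R \<mu>\<bar> < e"
    using R_near[OF subsetD[OF M_laws \<mu>] e] by blast
  \<comment> \<open>Half the radius of \<open>weak_ball K \<mu>\<close>: one half for the distance
    of the sample from \<open>\<nu>\<close>, the other for that of \<open>\<nu>\<close> from
    \<open>\<mu>\<close>. The index \<open>2 * K + 1\<close> below is chosen so that its radius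
    \<open>1 / (2 * K + 2)\<close> is exactly \<open>d\<close>.\<close>
  define d where "d = 1 / (2 * real (K + 1))"
  have d: "d > 0" by (simp add: d_def)
  have "(\<lambda>n. real K * (2 * exp (-2 * real n * d\<^sup>2))) \<longlonglongrightarrow> real K * (2 * 0)"
  proof (intro tendsto_mult tendsto_const)
    have "(\<lambda>n. exp (-2 * d\<^sup>2) ^ n) \<longlonglongrightarrow> 0" using d by (intro LIMSEQ_realpow_zero) auto
    then show "(\<lambda>n. exp (-2 * real n * d\<^sup>2)) \<longlonglongrightarrow> 0"
      by (simp add: exp_of_nat_mult[symmetric] ac_simps)
  qed
  from order_tendstoD(2)[OF this, of "e / 2"]
  have "\<forall>\<^sub>F n in sequentially. real K * (2 * exp (-2 * real n * d\<^sup>2)) < e / 2" using e by simp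
  then obtain N where N: "\<And>n. n \<ge> N \<Longrightarrow> real K * (2 * exp (-2 * real n * d\<^sup>2)) < e / 2"
    unfolding eventually_sequentially by blast
  have "measure (distr (Pi\<^sub>M UNIV (\<lambda>_. \<nu>)) borel (\<lambda>x. R (empirical_measure n x))) {y. e \<le> \<bar>y - R \<mu>\<bar>} \<le> e"
    if \<nu>: "\<nu> \<in> M" "\<nu> \<in> weak_ball (2 * K + 1) \<mu>" and n: "n \<ge> N" "n \<ge> 1" for \<nu> n
  proof -
    interpret \<nu>: real_distribution \<nu> using \<nu> M_real_distribution by blast
    let ?Q = "Pi\<^sub>M UNIV (\<lambda>_::nat. \<nu>)"
    interpret Q: product_prob_space "\<lambda>_::nat. \<nu>" UNIV ..
    have setsQ: "sets ?Q = sets (Pi\<^sub>M UNIV (\<lambda>_::nat. borel))" by (intro sets_PiM_cong) simp_all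
    have T[measurable]: "(\<lambda>x. R (empirical_measure n x)) \<in> borel_measurable ?Q"
      using plug_in_measurable[OF n(2)] by (simp cong: measurable_cong_sets[OF setsQ refl])
    define D where "D k = {x\<in>space ?Q.
      d \<le> \<bar>integral\<^sup>L (empirical_measure n x) (step_test k) - integral\<^sup>L \<nu> (step_test k)\<bar>}" for k
    define E where "E k = {x\<in>space ?Q.
      \<not> tail_integral \<Psi> k (a k) (empirical_measure n x) \<le> ennreal ((1/2) ^ k)}" for k
    have D: "D k \<in> sets ?Q" "Q.prob (D k) \<le> 2 * exp (-2 * real n * d\<^sup>2)" for k
    proof -
      have "(\<lambda>x. step_test k (x i)) \<in> borel_measurable ?Q" for i
        by (rule measurable_compose[OF measurable_component_singleton]) simp_all
      note [measurable] = this
      show "D k \<in> sets ?Q" unfolding D_def integral_empirical[OF step_test_measurable] by measurable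
      show "Q.prob (D k) \<le> 2 * exp (-2 * real n * d\<^sup>2)"
        unfolding D_def by (rule empirical_step_test_deviation[OF \<nu>.real_distribution_axioms n(2) d])
    qed
    have e4: "0 \<le> e / 4" using e by simp
    have E: "E k \<in> sets ?Q" "Q.prob (E k) \<le> (1/2) ^ k * (e / 4)" for k
      unfolding E_def
      by (rule empirical_tail_deviation[OF \<nu>.real_distribution_axioms n(2) e4 a[OF \<nu>(1)]])+
    let ?bad = "{x\<in>space ?Q. e \<le> \<bar>R (empirical_measure n x) - R \<mu>\<bar>}"
    have sub: "?bad \<subseteq> (\<Union>k\<in>{..<K}. D k) \<union> (\<Union>k\<in>{..<K}. E k)"
    proof
      fix x assume x: "x \<in> ?bad"
      show "x \<in> (\<Union>k\<in>{..<K}. D k) \<union> (\<Union>k\<in>{..<K}. E k)"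
      proof (rule ccontr)
        assume nx: "x \<notin> (\<Union>k\<in>{..<K}. D k) \<union> (\<Union>k\<in>{..<K}. E k)"
        let ?emp = "empirical_measure n x"
        have "?emp \<in> weak_ball K \<mu>"
          unfolding weak_ball_def
        proof (intro CollectI conjI allI impI)
          show "?emp \<in> space (prob_algebra borel)"
            by (simp add: space_prob_algebra_borel_iff real_distribution_empirical[OF n(2)])
          fix k assume k: "k < K"
          have "\<bar>integral\<^sup>L ?emp (step_test k) - integral\<^sup>L \<nu> (step_test k)\<bar> < d"
            using nx k x by (auto simp: D_def not_le)
          moreover have "\<bar>integral\<^sup>L \<nu> (step_test k) - integral\<^sup>L \<mu> (step_test k)\<bar> < 1 / real (2 * K + 1 + 1)"
            using \<nu>(2) k unfolding weak_ball_def by simp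
          moreover have "1 / real (2 * K + 1 + 1) = d" "1 / real (K + 1) = d + d"
            by (simp_all add: d_def field_simps)
          ultimately show "\<bar>integral\<^sup>L ?emp (step_test k) - integral\<^sup>L \<mu> (step_test k)\<bar> < 1 / real (K + 1)"
            by linarith
        qed
        moreover have "\<forall>k<K. tail_integral \<Psi> k (a k) ?emp \<le> ennreal ((1/2) ^ k)"
          using nx x by (auto simp: E_def)
        ultimately have "\<bar>R ?emp - R \<mu>\<bar> < e" using K empirical_in_laws[OF n(2)] by blast
        then show False using x by simp
      qed
    qed
    have "Q.prob ?bad \<le> Q.prob ((\<Union>k\<in>{..<K}. D k) \<union> (\<Union>k\<in>{..<K}. E k))"
      by (rule Q.finite_measure_mono[OF sub]) (use D(1) E(1) in auto)
    also have "\<dots> \<le> Q.prob (\<Union>k\<in>{..<K}. D k) + Q.prob (\<Union>k\<in>{..<K}. E k)"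
      by (rule measure_Un_le) (use D(1) E(1) in auto)
    also have "\<dots> \<le> (\<Sum>k<K. Q.prob (D k)) + (\<Sum>k<K. Q.prob (E k))"
      by (intro add_mono Q.finite_measure_subadditive_finite) (use D(1) E(1) in auto)
    also have "\<dots> \<le> (\<Sum>k<K. 2 * exp (-2 * real n * d\<^sup>2)) + (\<Sum>k<K. (1/2) ^ k * (e / 4))"
      by (intro add_mono sum_mono D(2) E(2))
    also have "(\<Sum>k<K. 2 * exp (-2 * real n * d\<^sup>2)) \<le> e / 2" using N[OF n(1)] by simp
    also have "(\<Sum>k<K. (1/2) ^ k * (e / 4)) = (\<Sum>k<K. (1/2) ^ k) * (e / 4)" by (simp add: sum_distrib_right)
    also have "\<dots> \<le> 2 * (e / 4)"
    proof (rule mult_right_mono)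
      show "(\<Sum>k<K. (1/2) ^ k) \<le> (2::real)" by (subst geometric_sum) (simp_all add: field_simps)
    qed (use e in simp)
    finally have "Q.prob ?bad \<le> e" by simp
    then show ?thesis
      by (subst measure_distr) (auto simp: vimage_def Int_def conj_commute)
  qed
  then show ?thesis by (intro exI[of _ "2 * K + 1"] exI[of _ N]) blast
qed

lemma robust_on_plug_in: "robust_on (\<lambda>n x. R (empirical_measure n x)) M"
  unfolding robust_on_def
proof (intro conjI ballI allI impI)
  show "(\<lambda>x. R (empirical_measure n x)) \<in> borel_measurable (Pi\<^sub>M UNIV (\<lambda>_. borel))" if "1 \<le> n" for n
    using that by (rule plug_in_measurable)
next
  let ?L = "\<lambda>\<nu> n. distr (Pi\<^sub>M UNIV (\<lambda>_::nat. \<nu>)) borel (\<lambda>x. R (empirical_measure n x))"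
  fix \<mu> and e :: real assume \<mu>: "\<mu> \<in> M" and e: "0 < e"
  have rd: "real_distribution \<mu>" using \<mu> by (rule M_real_distribution)
  have e2: "e / 2 > 0" using e by simp
  obtain K0 N where large: "\<And>\<nu> n. \<nu> \<in> M \<Longrightarrow> \<nu> \<in> weak_ball K0 \<mu> \<Longrightarrow> n \<ge> N \<Longrightarrow> n \<ge> 1 \<Longrightarrow>
      measure (?L \<nu> n) {y. e / 2 \<le> \<bar>y - R \<mu>\<bar>} \<le> e / 2"
    using large_sample[OF \<mu> e2] by blast
  have "\<exists>K. n \<ge> 1 \<longrightarrow> (\<forall>\<nu>\<in>weak_ball K \<mu>. prohorov_dist (?L \<mu> n) (?L \<nu> n) \<le> e)" for n
    using small_sample[OF _ e rd] by blast
  then obtain K where small: "\<And>n \<nu>. n \<ge> 1 \<Longrightarrow> \<nu> \<in> weak_ball (K n) \<mu> \<Longrightarrow> prohorov_dist (?L \<mu> n) (?L \<nu> n) \<le> e"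
    by metis
  \<comment> \<open>Each sample size below \<open>N\<close> has its own ball from
    \<open>small_sample\<close>; their finite number allows one ball inside all of them and inside
    that of \<open>large_sample\<close>.\<close>
  define K' where "K' = Max (insert K0 (K ` {..<N}))"
  have K': "K0 \<le> K'" "\<And>n. n < N \<Longrightarrow> K n \<le> K'" by (auto simp: K'_def)
  have rdL: "real_distribution (?L \<nu> n)" if "\<nu> \<in> M" "n \<ge> 1" for \<nu> n
  proof -
    interpret \<nu>: real_distribution \<nu> using that M_real_distribution by blast
    interpret Q: product_prob_space "\<lambda>_::nat. \<nu>" UNIV ..
    have setsQ: "sets (Pi\<^sub>M UNIV (\<lambda>_::nat. \<nu>)) = sets (Pi\<^sub>M UNIV (\<lambda>_::nat. borel))"
      by (intro sets_PiM_cong) simp_all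
    show ?thesis
      using plug_in_measurable[OF that(2)]
      by (intro Q.real_distribution_distr) (simp cong: measurable_cong_sets[OF setsQ refl])
  qed
  have "prohorov_dist (?L \<mu> n) (?L \<nu> n) \<le> e" if \<nu>: "\<nu> \<in> M \<inter> weak_ball K' \<mu>" and n: "n \<ge> 1" for \<nu> n
  proof (cases "n < N")
    case True
    then show ?thesis using small[OF n, of \<nu>] weak_ball_antimono[OF K'(2)] \<nu> by blast
  next
    case False
    have "\<nu> \<in> weak_ball K0 \<mu>" using \<nu> weak_ball_antimono[OF K'(1)] by blast
    moreover have "\<mu> \<in> weak_ball K0 \<mu>"
      using rd by (simp add: weak_ball_center space_prob_algebra_borel_iff)
    \<comment> \<open>The centre \<open>\<mu>\<close> lies in its own ball, so concentration around
      \<open>R \<mu>\<close> holds for both laws.\<close>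
    ultimately have "prohorov_dist (?L \<mu> n) (?L \<nu> n) \<le> 2 * (e / 2)"
      using False \<nu> \<mu> n e2 by (intro prohorov_dist_concentrated[of _ _ _ "R \<mu>"] rdL large) auto
    then show ?thesis by simp
  qed
  moreover have "openin (subtopology weak_topology M) (M \<inter> weak_ball K' \<mu>)"
    by (rule openin_subtopology_Int2[OF openin_weak_ball])
  moreover have "\<mu> \<in> M \<inter> weak_ball K' \<mu>"
    using \<mu> rd by (simp add: weak_ball_center space_prob_algebra_borel_iff)
  ultimately show "\<exists>U. openin (subtopology weak_topology M) U \<and> \<mu> \<in> U \<and>
     (\<forall>\<nu>\<in>U. \<forall>n\<ge>1. prohorov_dist (?L \<mu> n) (?L \<nu> n) \<le> e)" by blast
qed

end

theorem theorem4p20: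
  fixes \<Psi> :: "real \<Rightarrow> real"
    and P :: "'a measure"
    and \<rho> :: "('a \<Rightarrow> real) \<Rightarrow> real"
    and R :: "real measure \<Rightarrow> real"
    and A :: "real ^ 'd \<Rightarrow> real"
    and b c :: real
    and \<mu> :: "'d \<Rightarrow> real measure"
  assumes "finite_young_function \<Psi>"
    and "atomless_prob_space P"
    and "law_invariant_convex_risk_measure P \<Psi> \<rho>"
    and "is_risk_functional P \<Psi> \<rho> R"
    and "A \<in> borel_measurable borel"
    and "b > 0" and "c > 0"
    and "\<And>x. \<bar>A x\<bar> \<le> b + c * (\<Sum>i\<in>UNIV. \<bar>x $ i\<bar>)"
    and "\<And>i. \<mu> i \<in> orlicz_heart_laws P \<Psi>"
  shows "continuous_map (subtopology weak_topology (aggregate_laws \<mu> A)) euclideanreal R \<and>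
    robust_on (\<lambda>n x. R (empirical_measure n x)) (aggregate_laws \<mu> A)"
proof -
  interpret orlicz_risk_measure \<Psi> P \<rho> R
    by unfold_locales (rule assms)+
  have \<mu>: "real_distribution (\<mu> i)" "(\<integral>\<^sup>+x. ennreal (\<Psi> \<bar>real k * x\<bar>) \<partial>\<mu> i) < \<infinity>" for i k
    using assms(9)[of i] unfolding orlicz_heart_laws_iff by blast+
  have tails: "\<exists>a. \<forall>\<nu>\<in>aggregate_laws \<mu> A. tail_integral \<Psi> k a \<nu> \<le> ennreal e" if "e > 0" for k e
    using assms(5-8) \<mu> that by (rule aggregate_tails)
  interpret uniform_tails \<Psi> P \<rho> R "aggregate_laws \<mu> A"
  proof
    show "aggregate_laws \<mu> A \<subseteq> orlicz_heart_laws P \<Psi>"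
    proof
      fix \<nu> assume \<nu>: "\<nu> \<in> aggregate_laws \<mu> A"
      then obtain \<kappa> where \<kappa>: "\<nu> = distr \<kappa> borel A" "\<kappa> \<in> space (prob_algebra borel)"
        by (auto simp: aggregate_laws_def frechet_class_def)
      then have "A \<in> borel_measurable \<kappa>" "prob_space \<kappa>"
        using assms(5) by (auto simp: space_prob_algebra cong: measurable_cong_sets)
      then have rd: "real_distribution \<nu>" unfolding \<kappa>(1) by (intro prob_space.real_distribution_distr)
      have "(\<integral>\<^sup>+x. ennreal (\<Psi> \<bar>real k * x\<bar>) \<partial>\<nu>) < \<infinity>" for k
      proof -
        \<comment> \<open>Any finite tail bound will do here: the part within \<open>a\<close> is
          bounded, so the uniform tail estimate also places the aggregate laws in the heart.\<close>
        obtain a where "tail_integral \<Psi> k a \<nu> \<le> ennreal 1" using tails[of 1 k] \<nu> by auto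
        then have "tail_integral \<Psi> k a \<nu> < \<infinity>" by (rule le_less_trans) simp
        then show ?thesis by (rule nn_integral_finite_if_tail_finite[OF rd])
      qed
      then show "\<nu> \<in> orlicz_heart_laws P \<Psi>" using rd orlicz_heart_laws_iff by blast
    qed
  qed (rule tails)
  show ?thesis using continuous_map_R robust_on_plug_in by blast
qed

end
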